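(* Let $\lambda=0$ and $\delta>0$. Let the permeability be a constant, $k(x,t)=k>0$, and let $\chi\in L^2(0,L)$. Define $G:L^2(0,T)\to L^2(0,T;L^2(0,L)\times L^2(0,L))$ as the map sending $s\in L^2(0,T)$ to the state $(u,p)$ that satisfies the one-dimensional poroviscoelastic system with all sources set to zero except $S(x,t)=s(t)\chi(x)$, that is, $$H_v u_{xxt}+H_e u_{xx}-p_x=0,\qquad u_{xt}-k p_{xx}=s(t)\chi(x)\quad\text{in }[0,L]\times[0,T],$$ $$u(0,t)=p(0,t)=0,\quad -k p_x(L,t)=0,\quad H_v u_{xt}(L,t)+H_e u_x(L,t)-p(L,t)=0\quad(t\in[0,T]),\qquad u_x(x,0)=0\quad(x\in[0,L]).$$ Let $j:L^2(0,T)\to\mathbb{R}$ be the reduced objective $$j(s)=\tfrac12\|u-u_d\|_{L^2(0,T;L^2(0,L))}^2+\tfrac12\|p-p_d\|_{L^2(0,T;L^2(0,L))}^2+\tfrac{\lambda}{2}\|s\|_{L^2(0,T)}^2,\qquad (u,p)=Gs+(\tilde u,\tilde p),$$ with $\lambda=0$. Then the following assumption does not hold: $j$ is twice Fréchet differentiable and there is some $C>0$ such that $$|\nabla^2 j(w)(\psi,\varphi)|\le C\|\psi\|_{L^1(0,T)}\|\varphi\|_{L^1(0,T)}\quad\text{for all }w,\psi,\varphi\in L^2(0,T).$$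
   Context: $T,L>0$; $H_e=\lambda_e+2\mu_e$ and $H_v=\delta(\lambda_v+2\mu_v)$, where $\lambda_e,\mu_e$ are the (strictly positive) Lamé parameters and $\lambda_v,\mu_v$ the (strictly positive) viscoelastic parameters, and $\delta\ge 0$ measures the extent of structural viscoelasticity. $u$ is the elastic displacement and $p$ the fluid pressure; subscripts $x,t$ denote partial derivatives. $\lambda\ge0$ is the weight of the Tikhonov term. $u_d,p_d\in L^2(0,T;L^2(0,L))$ are given target functions, and $(\tilde u,\tilde p)$ is the fixed state produced by the remaining given data with zero control. The state is understood as the unique weak solution of the system, with $u\in H^1(0,T;V_0)$ and $p\in L^2(0,T;V_0)$, where $V_0=\{v\in H^1(0,L):v(0)=0\}$; it depends linearly and continuously on $s\in L^2(0,T)$.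
   Formalization: The formal theorem additionally assumes that χ is not almost everywhere zero; for χ = 0 the map G is zero, j is constant and the assumption holds trivially, so the statement as written is false in that case. *)

theory Defs
  imports "HOL-Analysis.Analysis"
begin

text \<open>
  Elements of Lebesgue and Sobolev spaces are represented by functions, and equality in these
  spaces is equality almost everywhere. A function of time and space is written \<open>u t x\<close>, so that
  \<open>u t\<close> is the spatial profile at time \<open>t\<close>.
\<close>

section \<open>Lebesgue spaces\<close>

definition ivl :: "real \<Rightarrow> real measure" where
  "ivl a = restrict_space lborel {0<..<a}"

definition l2_space :: "'a measure \<Rightarrow> ('a \<Rightarrow> real) set" where
  "l2_space M = {f \<in> borel_measurable M. integrable M (\<lambda>x. (f x)\<^sup>2)}"

definition l2_norm :: "'a measure \<Rightarrow> ('a \<Rightarrow> real) \<Rightarrow> real" where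
  "l2_norm M f = sqrt (\<integral>x. (f x)\<^sup>2 \<partial>M)"

definition l1_norm :: "'a measure \<Rightarrow> ('a \<Rightarrow> real) \<Rightarrow> real" where
  "l1_norm M f = (\<integral>x. \<bar>f x\<bar> \<partial>M)"

text \<open>\<open>L\<^sup>2(0,T;L\<^sup>2(0,L))\<close>, under the usual identification with \<open>L\<^sup>2((0,T) \<times> (0,L))\<close>.\<close>

definition L2L2 :: "real \<Rightarrow> real \<Rightarrow> (real \<Rightarrow> real \<Rightarrow> real) set" where
  "L2L2 T L = {u. (\<lambda>(t, x). u t x) \<in> l2_space (ivl T \<Otimes>\<^sub>M ivl L)}"

definition L2L2_norm :: "real \<Rightarrow> real \<Rightarrow> (real \<Rightarrow> real \<Rightarrow> real) \<Rightarrow> real" where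
  "L2L2_norm T L u = l2_norm (ivl T) (\<lambda>t. l2_norm (ivl L) (u t))"


section \<open>Sobolev spaces\<close>

text \<open>Test functions \<open>C\<^sup>1\<^sub>c(0,a)\<close>; in dimension one these give the same weak derivatives as smooth ones.\<close>

definition test_funs :: "real \<Rightarrow> (real \<Rightarrow> real) set" where
  "test_funs a = {\<phi>. \<phi> C1_differentiable_on UNIV \<and>
     (\<exists>K. compact K \<and> K \<subseteq> {0<..<a} \<and> (\<forall>x. x \<notin> K \<longrightarrow> \<phi> x = 0))}"

definition has_weak_deriv :: "real \<Rightarrow> (real \<Rightarrow> real) \<Rightarrow> (real \<Rightarrow> real) \<Rightarrow> bool" where
  "has_weak_deriv a f g \<longleftrightarrow>
     (\<forall>\<phi>\<in>test_funs a. (\<integral>x. f x * deriv \<phi> x \<partial>ivl a) = - (\<integral>x. g x * \<phi> x \<partial>ivl a))"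

definition H1 :: "real \<Rightarrow> (real \<Rightarrow> real) set" where
  "H1 a = {f \<in> l2_space (ivl a). \<exists>g\<in>l2_space (ivl a). has_weak_deriv a f g}"

text \<open>The value at \<open>0\<close> is that of the continuous representative.\<close>

definition V0 :: "real \<Rightarrow> (real \<Rightarrow> real) set" where
  "V0 a = {f \<in> H1 a. \<exists>f'. continuous_on {0..a} f' \<and> (AE x in ivl a. f x = f' x) \<and> f' 0 = 0}"

definition has_dx :: "real \<Rightarrow> real \<Rightarrow> (real \<Rightarrow> real \<Rightarrow> real) \<Rightarrow> (real \<Rightarrow> real \<Rightarrow> real) \<Rightarrow> bool" where
  "has_dx T L u ux \<longleftrightarrow> ux \<in> L2L2 T L \<and> (AE t in ivl T. has_weak_deriv L (u t) (ux t))"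

definition L2V0 :: "real \<Rightarrow> real \<Rightarrow> (real \<Rightarrow> real \<Rightarrow> real) set" where
  "L2V0 T L = {u \<in> L2L2 T L. (AE t in ivl T. u t \<in> V0 L) \<and> (\<exists>ux. has_dx T L u ux)}"

text \<open>
  Weak time derivative of a function with values in \<open>V\<^sub>0\<close> (or \<open>L\<^sup>2(0,L)\<close>): the defining identity
  between Bochner integrals over \<open>(0,T)\<close> is an identity between elements of that space, i.e.
  between functions of \<open>x\<close> up to null sets.
\<close>

definition has_dt :: "real \<Rightarrow> real \<Rightarrow> (real \<Rightarrow> real \<Rightarrow> real) \<Rightarrow> (real \<Rightarrow> real \<Rightarrow> real) \<Rightarrow> bool" where
  "has_dt T L u ut \<longleftrightarrow> (\<forall>\<phi>\<in>test_funs T. AE x in ivl L.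
     (\<integral>t. u t x * deriv \<phi> t \<partial>ivl T) = - (\<integral>t. ut t x * \<phi> t \<partial>ivl T))"

definition H1V0 :: "real \<Rightarrow> real \<Rightarrow> (real \<Rightarrow> real \<Rightarrow> real) set" where
  "H1V0 T L = {u \<in> L2V0 T L. \<exists>ut\<in>L2V0 T L. has_dt T L u ut}"

text \<open>
  \<open>w(\<cdot>,0) = 0\<close> in \<open>L\<^sup>2(0,L)\<close> for \<open>w\<close> that agrees almost everywhere with an element \<open>W\<close>
  of \<open>C([0,T];L\<^sup>2(0,L))\<close>.
\<close>

definition zero_initial_value :: "real \<Rightarrow> real \<Rightarrow> (real \<Rightarrow> real \<Rightarrow> real) \<Rightarrow> bool" where
  "zero_initial_value T L w \<longleftrightarrow> (\<exists>W.
     (\<forall>t\<in>{0..T}. W t \<in> l2_space (ivl L)) \<and>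
     (\<forall>t\<in>{0..T}. ((\<lambda>r. l2_norm (ivl L) (\<lambda>x. W r x - W t x)) \<longlongrightarrow> 0) (at t within {0..T})) \<and>
     (AE t in ivl T. AE x in ivl L. W t x = w t x) \<and>
     (AE x in ivl L. W 0 x = 0))"


section \<open>The poroviscoelastic system\<close>

definition H_elastic :: "real \<Rightarrow> real \<Rightarrow> real" where
  "H_elastic lam_e mu_e = lam_e + 2 * mu_e"

definition H_visco :: "real \<Rightarrow> real \<Rightarrow> real \<Rightarrow> real" where
  "H_visco \<delta> lam_v mu_v = \<delta> * (lam_v + 2 * mu_v)"

text \<open>
  Weak solutions with zero data except the fluid source \<open>s(t) chi(x)\<close>. Both equations are tested
  with \<open>v \<in> V\<^sub>0\<close> and integrated by parts in \<open>x\<close>: the conditions at \<open>x = 0\<close> are part of \<open>V\<^sub>0\<close>, those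
  at \<open>x = L\<close> (zero total stress \<open>H\<^sub>v u\<^sub>x\<^sub>t + H\<^sub>e u\<^sub>x - p\<close> and zero flux \<open>-k p\<^sub>x\<close>) are natural, so no
  boundary terms remain.
\<close>

definition weak_solution ::
  "real \<Rightarrow> real \<Rightarrow> real \<Rightarrow> real \<Rightarrow> real \<Rightarrow> (real \<Rightarrow> real) \<Rightarrow> (real \<Rightarrow> real)
    \<Rightarrow> (real \<Rightarrow> real \<Rightarrow> real) \<times> (real \<Rightarrow> real \<Rightarrow> real) \<Rightarrow> bool" where
  "weak_solution T L He Hv k chi s = (\<lambda>(u, p).
     u \<in> H1V0 T L \<and> p \<in> L2V0 T L \<and>
     (\<exists>ut ux uxt px.
        ut \<in> L2V0 T L \<and> has_dt T L u ut \<and>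
        has_dx T L u ux \<and> has_dx T L ut uxt \<and> has_dx T L p px \<and>
        (AE t in ivl T. \<forall>v vx. v \<in> V0 L \<and> vx \<in> l2_space (ivl L) \<and> has_weak_deriv L v vx \<longrightarrow>
           (\<integral>x. (Hv * uxt t x + He * ux t x - p t x) * vx x \<partial>ivl L) = 0 \<and>
           (\<integral>x. uxt t x * v x \<partial>ivl L) + (\<integral>x. k * px t x * vx x \<partial>ivl L)
             = (\<integral>x. s t * chi x * v x \<partial>ivl L)) \<and>
        zero_initial_value T L ux))"

definition reduced_objective ::
  "real \<Rightarrow> real \<Rightarrow> real
    \<Rightarrow> ((real \<Rightarrow> real) \<Rightarrow> (real \<Rightarrow> real \<Rightarrow> real) \<times> (real \<Rightarrow> real \<Rightarrow> real))
    \<Rightarrow> (real \<Rightarrow> real \<Rightarrow> real) \<Rightarrow> (real \<Rightarrow> real \<Rightarrow> real)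
    \<Rightarrow> (real \<Rightarrow> real \<Rightarrow> real) \<Rightarrow> (real \<Rightarrow> real \<Rightarrow> real) \<Rightarrow> (real \<Rightarrow> real) \<Rightarrow> real" where
  "reduced_objective T L lam G u0 p0 ud pd s =
     1 / 2 * (L2L2_norm T L (\<lambda>t x. fst (G s) t x + u0 t x - ud t x))\<^sup>2 +
     1 / 2 * (L2L2_norm T L (\<lambda>t x. snd (G s) t x + p0 t x - pd t x))\<^sup>2 +
     lam / 2 * (l2_norm (ivl T) s)\<^sup>2"


section \<open>Twice Frechet differentiable functionals on \<open>L\<^sup>2\<close>\<close>

definition l2_linear :: "'a measure \<Rightarrow> (('a \<Rightarrow> real) \<Rightarrow> real) \<Rightarrow> bool" where
  "l2_linear M F \<longleftrightarrow> (\<forall>f\<in>l2_space M. \<forall>g\<in>l2_space M. \<forall>a b.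
     F (\<lambda>x. a * f x + b * g x) = a * F f + b * F g)"

definition l2_bounded_linear :: "'a measure \<Rightarrow> (('a \<Rightarrow> real) \<Rightarrow> real) \<Rightarrow> bool" where
  "l2_bounded_linear M F \<longleftrightarrow> l2_linear M F \<and>
     (\<exists>B. \<forall>f\<in>l2_space M. \<bar>F f\<bar> \<le> B * l2_norm M f)"

definition l2_bounded_bilinear ::
  "'a measure \<Rightarrow> (('a \<Rightarrow> real) \<Rightarrow> ('a \<Rightarrow> real) \<Rightarrow> real) \<Rightarrow> bool" where
  "l2_bounded_bilinear M F \<longleftrightarrow>
     (\<forall>f\<in>l2_space M. l2_linear M (F f) \<and> l2_linear M (\<lambda>g. F g f)) \<and>
     (\<exists>B. \<forall>f\<in>l2_space M. \<forall>g\<in>l2_space M. \<bar>F f g\<bar> \<le> B * l2_norm M f * l2_norm M g)"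

definition l2_frechet_deriv ::
  "'a measure \<Rightarrow> (('a \<Rightarrow> real) \<Rightarrow> real) \<Rightarrow> (('a \<Rightarrow> real) \<Rightarrow> ('a \<Rightarrow> real) \<Rightarrow> real) \<Rightarrow> bool" where
  "l2_frechet_deriv M j D \<longleftrightarrow> (\<forall>w\<in>l2_space M. l2_bounded_linear M (D w) \<and>
     (\<forall>\<epsilon>>0. \<exists>d>0. \<forall>h\<in>l2_space M. l2_norm M h < d \<longrightarrow>
        \<bar>j (\<lambda>x. w x + h x) - j w - D w h\<bar> \<le> \<epsilon> * l2_norm M h))"

text \<open>\<open>D2\<close> is the derivative of \<open>D\<close> as a map into the dual space with the operator norm.\<close>

definition l2_second_frechet_deriv ::
  "'a measure \<Rightarrow> (('a \<Rightarrow> real) \<Rightarrow> real)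
    \<Rightarrow> (('a \<Rightarrow> real) \<Rightarrow> ('a \<Rightarrow> real) \<Rightarrow> ('a \<Rightarrow> real) \<Rightarrow> real) \<Rightarrow> bool" where
  "l2_second_frechet_deriv M j D2 \<longleftrightarrow> (\<exists>D. l2_frechet_deriv M j D \<and>
     (\<forall>w\<in>l2_space M. l2_bounded_bilinear M (D2 w) \<and>
       (\<forall>\<epsilon>>0. \<exists>d>0. \<forall>h\<in>l2_space M. l2_norm M h < d \<longrightarrow>
          (\<forall>\<phi>\<in>l2_space M. \<bar>D (\<lambda>x. w x + h x) \<phi> - D w \<phi> - D2 w h \<phi>\<bar>
             \<le> \<epsilon> * l2_norm M h * l2_norm M \<phi>))))"

definition hessian_L1_bounded :: "real \<Rightarrow> ((real \<Rightarrow> real) \<Rightarrow> real) \<Rightarrow> bool" where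
  "hessian_L1_bounded T j \<longleftrightarrow> (\<exists>D2. l2_second_frechet_deriv (ivl T) j D2 \<and>
     (\<exists>C>0. \<forall>w\<in>l2_space (ivl T). \<forall>\<psi>\<in>l2_space (ivl T). \<forall>\<phi>\<in>l2_space (ivl T).
        \<bar>D2 w \<psi> \<phi>\<bar> \<le> C * l1_norm (ivl T) \<psi> * l1_norm (ivl T) \<phi>))"

end

theory Submission
  imports Defs
begin

text \<open>
  Test both equations with a fixed \<open>v \<in> C\<^sup>2\<^sub>c(0,L)\<close> such that \<open>c = \<integral> chi v \<noteq> 0\<close>. With \<open>a = H\<^sub>e / H\<^sub>v\<close>, the
  tested strain \<open>f = \<integral> u\<^sub>x v\<close> satisfies \<open>f' + a f = \<integral> p v / H\<^sub>v\<close> and \<open>c s = f' - k \<integral> p v''\<close>. For a source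
  \<open>s = \<phi>' - a \<phi>\<close> with \<open>\<phi>\<close> compactly supported in \<open>(0,T)\<close>, multiplying by \<open>s\<close> and integrating by
  parts in time eliminates \<open>f\<close>, so that \<open>c \<parallel>s\<parallel>\<^sup>2\<close> is a pairing of \<open>p\<close> with functions controlled by \<open>s\<close>
  and \<open>\<phi>\<close>; hence \<open>\<parallel>s\<parallel>\<^sup>2 \<le> \<rho> \<parallel>p\<parallel>\<^sup>2 + \<parallel>\<phi>\<parallel>\<^sup>2\<close>.
  An \<open>L\<^sup>1\<close> bound on the Hessian gives \<open>j(s) \<le> j(0) + B \<parallel>s\<parallel>\<^sub>2 + C \<parallel>s\<parallel>\<^sub>1\<^sup>2\<close> by the mean value theorem, and so
  \<open>\<parallel>s\<parallel>\<^sub>2\<^sup>2 \<le> K\<^sub>0 + K\<^sub>1 \<parallel>s\<parallel>\<^sub>2\<close> as long as \<open>\<phi>\<close> and \<open>\<parallel>s\<parallel>\<^sub>1\<close> stay bounded. Rescaled bumps \<open>\<phi>\<close> of width \<open>1/n\<close> have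
  \<open>\<parallel>s\<parallel>\<^sub>1\<close> bounded but \<open>\<parallel>s\<parallel>\<^sub>2 \<rightarrow> \<infinity>\<close>, a contradiction.
\<close>

section \<open>Lebesgue spaces on intervals\<close>

lemma integral_ivl: "(\<integral>x. f x \<partial>ivl a) = (\<integral>x. indicator {0<..<a} x * f x \<partial>lborel)" for f :: "real \<Rightarrow> real"
  unfolding ivl_def by (subst integral_restrict_space) auto

lemma integrable_ivl_iff:
  "integrable (ivl a) f \<longleftrightarrow> integrable lborel (\<lambda>x. indicator {0<..<a} x * f x)" for f :: "real \<Rightarrow> real"
  unfolding ivl_def by (subst integrable_restrict_space) auto

lemma AE_ivl_iff: "(AE x in ivl a. P x) \<longleftrightarrow> (AE x in lborel. x \<in> {0<..<a} \<longrightarrow> P x)"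
  unfolding ivl_def by (subst AE_restrict_space_iff) auto

lemma space_ivl [simp]: "space (ivl a) = {0<..<a}"
  by (simp add: ivl_def space_restrict_space)

lemma finite_measure_ivl: "finite_measure (ivl a)"
  by (rule finite_measureI) (simp add: ivl_def emeasure_restrict_space, cases "a \<ge> 0", auto)

lemma measure_ivl: "a > 0 \<Longrightarrow> measure (ivl a) {0<..<a} = a"
  by (simp add: ivl_def measure_restrict_space)

lemma measurable_ivl: "f \<in> borel_measurable borel \<Longrightarrow> f \<in> borel_measurable (ivl a)"
  for f :: "real \<Rightarrow> real"
  unfolding ivl_def by (intro measurable_restrict_space1) simp

lemma continuous_measurable_ivl: "continuous_on UNIV f \<Longrightarrow> f \<in> borel_measurable (ivl a)"
  for f :: "real \<Rightarrow> real"
  by (intro measurable_ivl borel_measurable_continuous_onI)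

lemma continuous_bounded_ivl:
  fixes f :: "real \<Rightarrow> real"
  assumes "continuous_on UNIV f"
  obtains B where "B > 0" "\<And>x. x \<in> {0<..<a} \<Longrightarrow> \<bar>f x\<bar> \<le> B"
proof -
  have "compact (f ` {0..a})"
    using assms by (intro compact_continuous_image) (auto intro: continuous_on_subset)
  then have "bounded (f ` {0..a})" by (rule compact_imp_bounded)
  then obtain B where B: "B > 0" "\<And>y. y \<in> f ` {0..a} \<Longrightarrow> norm y \<le> B"
    unfolding bounded_pos by blast
  show thesis by (rule that[of B]) (use B in auto)
qed

lemma integrable_ivl_bounded:
  fixes f :: "real \<Rightarrow> real"
  assumes "f \<in> borel_measurable (ivl a)" "\<And>x. x \<in> {0<..<a} \<Longrightarrow> \<bar>f x\<bar> \<le> B"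
  shows "integrable (ivl a) f"
proof -
  interpret finite_measure "ivl a" by (rule finite_measure_ivl)
  show ?thesis
    by (rule integrable_const_bound[where B = B]) (use assms in auto)
qed

lemma integrable_continuous_ivl:
  fixes f :: "real \<Rightarrow> real"
  assumes "continuous_on UNIV f"
  shows "integrable (ivl a) f"
proof -
  obtain B where "\<And>x. x \<in> {0<..<a} \<Longrightarrow> \<bar>f x\<bar> \<le> B"
    using continuous_bounded_ivl[OF assms, of a] by metis
  then show ?thesis
    by (intro integrable_ivl_bounded continuous_measurable_ivl assms)
qed

lemma l2_space_continuous:
  fixes f :: "real \<Rightarrow> real"
  assumes "continuous_on UNIV f"
  shows "f \<in> l2_space (ivl a)"
  unfolding l2_space_def
  by (auto intro!: continuous_measurable_ivl integrable_continuous_ivl continuous_intros assms)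

lemma l2_norm_sq: "(l2_norm M f)\<^sup>2 = (\<integral>x. (f x)\<^sup>2 \<partial>M)"
  unfolding l2_norm_def by simp

lemma integrable_l2_space:
  assumes "finite_measure M" "f \<in> l2_space M"
  shows "integrable M f"
proof -
  interpret finite_measure M by fact
  have sq: "f \<in> borel_measurable M" "integrable M (\<lambda>x. (f x)\<^sup>2)" using assms(2) by (auto simp: l2_space_def)
  have "integrable M (\<lambda>x. 1 + (f x)\<^sup>2)" using sq by auto
  then show ?thesis
  proof (rule Bochner_Integration.integrable_bound)
    show "AE x in M. norm (f x) \<le> norm (1 + (f x)\<^sup>2)"
    proof (rule AE_I2)
      fix x
      have "0 \<le> (\<bar>f x\<bar> - 1)\<^sup>2" by simp
      then show "norm (f x) \<le> norm (1 + (f x)\<^sup>2)"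
        by (simp add: power2_eq_square algebra_simps abs_mult_self_eq)
    qed
  qed (use sq in auto)
qed

lemma integrable_mult_l2_space:
  fixes f g :: "'a \<Rightarrow> real"
  assumes "f \<in> l2_space M" "g \<in> l2_space M"
  shows "integrable M (\<lambda>x. f x * g x)"
proof -
  have m: "f \<in> borel_measurable M" "integrable M (\<lambda>x. (f x)\<^sup>2)" "g \<in> borel_measurable M" "integrable M (\<lambda>x. (g x)\<^sup>2)"
    using assms by (auto simp: l2_space_def)
  show ?thesis
  proof (rule Bochner_Integration.integrable_bound)
    show "integrable M (\<lambda>x. (f x)\<^sup>2 + (g x)\<^sup>2)" using m by auto
    show "AE x in M. norm (f x * g x) \<le> norm ((f x)\<^sup>2 + (g x)\<^sup>2)"
    proof (rule AE_I2)
      fix x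
      have "2 * (\<bar>f x\<bar> * \<bar>g x\<bar>) \<le> (f x)\<^sup>2 + (g x)\<^sup>2"
        using sum_squares_bound[of "\<bar>f x\<bar>" "\<bar>g x\<bar>"] by simp
      moreover have "\<bar>f x\<bar> * \<bar>g x\<bar> \<ge> 0" by simp
      ultimately have "\<bar>f x\<bar> * \<bar>g x\<bar> \<le> (f x)\<^sup>2 + (g x)\<^sup>2" by linarith
      then show "norm (f x * g x) \<le> norm ((f x)\<^sup>2 + (g x)\<^sup>2)"
        by (simp add: abs_mult)
    qed
  qed (use m in auto)
qed

lemma l2_space_add:
  assumes "f \<in> l2_space M" "g \<in> l2_space M"
  shows "(\<lambda>x. f x + g x) \<in> l2_space M"
  using assms integrable_mult_l2_space[OF assms]
  by (auto simp: l2_space_def power2_sum mult.assoc)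

lemma l2_space_cmult: "f \<in> l2_space M \<Longrightarrow> (\<lambda>x. c * f x) \<in> l2_space M"
  by (auto simp: l2_space_def power_mult_distrib)

lemma l2_space_diff:
  assumes "f \<in> l2_space M" "g \<in> l2_space M"
  shows "(\<lambda>x. f x - g x) \<in> l2_space M"
  using l2_space_add[OF assms(1) l2_space_cmult[OF assms(2), of "-1"]] by simp

section \<open>Smooth test functions\<close>

text \<open>At the kink both one-sided derivatives vanish because the exponent is at least 2. This
  is the source of the regularity of all the truncated polynomials from which test functions are
  built below.\<close>

lemma max0_power_deriv:
  "((\<lambda>z::real. max 0 z ^ Suc (Suc m)) has_real_derivative (real (Suc (Suc m)) * max 0 z ^ Suc m)) (at z)"
proof -
  consider "z > 0" | "z < 0" | "z = 0" by linarith
  then show ?thesis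
  proof cases
    case 1
    have "((\<lambda>z::real. z ^ Suc (Suc m)) has_real_derivative (real (Suc (Suc m)) * z ^ Suc m)) (at z)"
      using DERIV_pow[of "Suc (Suc m)" z] by simp
    then show ?thesis
      by (subst DERIV_cong_ev[OF refl _ refl, where g = "\<lambda>z. z ^ Suc (Suc m)"])
         (use 1 in \<open>auto simp: max_def intro!: eventually_mono[OF eventually_nhds_in_open[of "{0<..}"]]\<close>)
  next
    case 2
    have "((\<lambda>z::real. 0) has_real_derivative 0) (at z)" by simp
    then show ?thesis
      by (subst DERIV_cong_ev[OF refl _ refl, where g = "\<lambda>z. 0"])
         (use 2 in \<open>auto simp: max_def intro!: eventually_mono[OF eventually_nhds_in_open[of "{..<0}"]]\<close>)
  next
    case 3
    \<comment> \<open>The difference quotient at 0 vanishes on the left and is a positive power of h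
      on the right, so a power of |h| dominates it.\<close>
    have "((\<lambda>h::real. max 0 h ^ Suc (Suc m) / h) \<longlongrightarrow> 0) (at 0)"
    proof (rule Lim_null_comparison)
      show "\<forall>\<^sub>F h in at 0. norm (max 0 h ^ Suc (Suc m) / h) \<le> \<bar>h\<bar> ^ Suc m"
        by (rule eventually_mono[OF eventually_at_ball'[of 1]]) (auto simp: max_def intro: mult_nonpos_nonneg)
      have "((\<lambda>h::real. \<bar>h\<bar> ^ Suc m) \<longlongrightarrow> \<bar>0\<bar> ^ Suc m) (at 0)" by (intro tendsto_intros)
      then show "((\<lambda>h::real. \<bar>h\<bar> ^ Suc m) \<longlongrightarrow> 0) (at 0)" by simp
    qed
    then show ?thesis using 3 by (simp add: DERIV_def)
  qed
qed

lemma integral_deriv_eq_0: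
  fixes F f :: "real \<Rightarrow> real"
  assumes "\<And>x. (F has_real_derivative f x) (at x)"
    and "continuous_on UNIV f" and "F 0 = 0" "F a = 0" "a \<ge> 0"
  shows "(\<integral>x. f x \<partial>ivl a) = 0"
proof -
  have "(\<integral>x. f x \<partial>ivl a) = (\<integral>x. indicator {0..a} x * f x \<partial>lborel)"
    unfolding integral_ivl
  proof (rule integral_cong_AE)
    \<comment> \<open>\<open>ivl\<close> lives on the open interval, the fundamental theorem of
      calculus on the closed one; the two endpoints form a null set.\<close>
    have "AE x in lborel. x \<noteq> 0 \<and> x \<noteq> a" 
      using AE_lborel_singleton[of 0] AE_lborel_singleton[of a] by eventually_elim auto
    then show "AE x in lborel. indicat_real {0<..<a} x * f x = indicat_real {0..a} x * f x"
      by eventually_elim (auto simp: indicator_def)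
    have [measurable]: "f \<in> borel_measurable borel"
      using assms(2) by (rule borel_measurable_continuous_onI)
    show "(\<lambda>x. indicat_real {0<..<a} x * f x) \<in> borel_measurable lborel"
      "(\<lambda>x. indicat_real {0..a} x * f x) \<in> borel_measurable lborel"
      by measurable
  qed
  also have "\<dots> = F a - F 0"
    using integral_FTC_atLeastAtMost[of 0 a F f] assms
    by (auto simp: has_real_derivative_iff_has_vector_derivative
        intro: has_vector_derivative_at_within continuous_on_subset)
  finally show ?thesis using assms by simp
qed

lemma test_funs_props:
  assumes "\<phi> \<in> test_funs a"
  shows "\<And>x. (\<phi> has_real_derivative deriv \<phi> x) (at x)" "continuous_on UNIV (deriv \<phi>)" "continuous_on UNIV \<phi>"
    "\<phi> 0 = 0" "\<phi> a = 0"
proof -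
  obtain D where D: "\<And>x. (\<phi> has_vector_derivative D x) (at x)" "continuous_on UNIV D"
    using assms unfolding test_funs_def C1_differentiable_on_def by auto
  then have d: "\<And>x. (\<phi> has_real_derivative D x) (at x)"
    by (simp add: has_real_derivative_iff_has_vector_derivative)
  then have eq: "deriv \<phi> = D" by (auto simp: fun_eq_iff intro!: DERIV_imp_deriv)
  show "\<And>x. (\<phi> has_real_derivative deriv \<phi> x) (at x)" "continuous_on UNIV (deriv \<phi>)"
    using d D eq by auto
  show "continuous_on UNIV \<phi>"
    by (rule DERIV_continuous_on) (use d in auto)
  show "\<phi> 0 = 0" "\<phi> a = 0" using assms unfolding test_funs_def by fastforce+
qed

lemma test_funsI:
  fixes f f' :: "real \<Rightarrow> real"
  assumes "\<And>x. (f has_real_derivative f' x) (at x)" "continuous_on UNIV f'"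
    "0 < b" "c < a" "\<And>x. x \<notin> {b..c} \<Longrightarrow> f x = 0"
  shows "f \<in> test_funs a" "deriv f = f'"
proof -
  show "f \<in> test_funs a"
    unfolding test_funs_def C1_differentiable_on_def mem_Collect_eq
  proof (intro conjI exI[of _ f'] exI[of _ "{b..c}"])
    show "\<forall>x\<in>UNIV. (f has_vector_derivative f' x) (at x)"
      using assms by (simp add: has_real_derivative_iff_has_vector_derivative)
  qed (use assms in auto)
  show "deriv f = f'"
    using assms by (auto simp: fun_eq_iff intro!: DERIV_imp_deriv)
qed

section \<open>Classical derivatives as weak derivatives\<close>

lemma has_weak_deriv_C1:
  fixes f f' :: "real \<Rightarrow> real"
  assumes f: "\<And>x. (f has_real_derivative f' x) (at x)" and f': "continuous_on UNIV f'" and "a > 0"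
  shows "has_weak_deriv a f f'"
  unfolding has_weak_deriv_def
proof
  fix \<phi> assume \<phi>: "\<phi> \<in> test_funs a"
  note t = test_funs_props[OF \<phi>]
  have cf: "continuous_on UNIV f" by (rule DERIV_continuous_on) (use f in auto)
  have i: "integrable (ivl a) (\<lambda>x. f x * deriv \<phi> x)" "integrable (ivl a) (\<lambda>x. f' x * \<phi> x)"
    by (auto intro!: integrable_continuous_ivl continuous_intros t f' cf)
  have "(\<integral>x. (f x * deriv \<phi> x + f' x * \<phi> x) \<partial>ivl a) = 0"
  proof (rule integral_deriv_eq_0[where F = "\<lambda>x. f x * \<phi> x"])
    show "((\<lambda>x. f x * \<phi> x) has_real_derivative f x * deriv \<phi> x + f' x * \<phi> x) (at x)" for x
      by (auto intro!: derivative_eq_intros f t)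
    show "continuous_on UNIV (\<lambda>x. f x * deriv \<phi> x + f' x * \<phi> x)"
      by (auto intro!: continuous_intros t f' cf)
  qed (use t \<open>a > 0\<close> in auto)
  then show "(\<integral>x. f x * deriv \<phi> x \<partial>ivl a) = - (\<integral>x. f' x * \<phi> x \<partial>ivl a)"
    using i by simp
qed

lemma V0_C1:
  fixes f f' :: "real \<Rightarrow> real"
  assumes "\<And>x. (f has_real_derivative f' x) (at x)" "continuous_on UNIV f'" "a > 0" "f 0 = 0"
  shows "f \<in> V0 a"
proof -
  have cf: "continuous_on UNIV f" by (rule DERIV_continuous_on) (use assms in auto)
  show ?thesis
    unfolding V0_def H1_def mem_Collect_eq
    by (intro conjI bexI[of _ f'] exI[of _ f] has_weak_deriv_C1 l2_space_continuous)
       (use assms cf in \<open>auto intro: continuous_on_subset\<close>)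
qed

text \<open>The stress equation contains the test function only through its derivative. An
  antiderivative vanishing at 0 belongs to \<open>V0\<close> and makes any continuous weight v
  available there.\<close>

lemma ex_antideriv:
  fixes v :: "real \<Rightarrow> real"
  assumes "continuous_on UNIV v"
  obtains V where "\<And>x. (V has_real_derivative v x) (at x)" "V 0 = 0"
proof -
  obtain F where "\<And>x. (F has_real_derivative v x) (at x)"
    using einterval_antiderivative[of "-\<infinity>" "\<infinity>" v] assms
    by (auto simp: has_real_derivative_iff_has_vector_derivative continuous_on_eq_continuous_at)
  then show thesis
    by (intro that[of "\<lambda>x. F x - F 0"]) (auto intro!: derivative_eq_intros)
qed

text \<open>The Borel sets over which f integrates to zero form a Dynkin system containing the open
  intervals, an intersection-stable generator. Hence all Borel sets qualify, in particular the sets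
  where f is positive and where it is negative.\<close>

lemma AE_eq_0_of_interval_integrals:
  fixes f :: "real \<Rightarrow> real"
  assumes f: "integrable lborel f"
    and int: "\<And>a b. (\<integral>x. indicator {a<..<b} x * f x \<partial>lborel) = 0"
  shows "AE x in lborel. f x = 0"
proof -
  have fi: "integrable lborel (\<lambda>x. indicator A x * f x)" if "A \<in> sets borel" for A :: "real set"
    using integrable_mult_indicator[of A lborel f] f that by simp
  \<comment> \<open>Stability under complements needs the integral over the whole line to vanish;
    the intervals (-n, n) exhaust the line, with |f| as the dominating function.\<close>
  have total: "(\<integral>x. f x \<partial>lborel) = 0"
  proof -
    have "(\<lambda>n. \<integral>x. indicator {- real n<..<real n} x * f x \<partial>lborel) \<longlonglongrightarrow> (\<integral>x. f x \<partial>lborel)"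
    proof (rule integral_dominated_convergence[where w = "\<lambda>x. norm (f x)"])
      show "AE x in lborel. (\<lambda>n. indicator {- real n<..<real n} x * f x) \<longlonglongrightarrow> f x"
      proof (rule AE_I2, rule tendsto_eventually)
        fix x :: real
        obtain N where N: "\<bar>x\<bar> < real N" using reals_Archimedean2 by blast
        show "\<forall>\<^sub>F n in sequentially. indicator {- real n<..<real n} x * f x = f x"
          using eventually_ge_at_top[of N] by eventually_elim (use N in \<open>auto simp: indicator_def\<close>)
      qed
    qed (use f in \<open>auto simp: indicator_def\<close>)
    then show ?thesis by (simp add: int LIMSEQ_const_iff)
  qed
  let ?G = "range (\<lambda>(a, b). {a<..<b :: real})"
  have sets_eq: "sets borel = sigma_sets UNIV ?G"
    by (subst borel_eq_box) (simp add: sets_measure_of_conv box_real case_prod_unfold)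
  have zero: "(\<integral>x. indicator A x * f x \<partial>lborel) = 0" if "A \<in> sigma_sets UNIV ?G" for A
  proof (rule sigma_sets_induct_disjoint[OF _ _ that])
    show "Int_stable ?G"
    proof (rule Int_stableI)
      fix A B assume "A \<in> ?G" "B \<in> ?G"
      then obtain a b c d where "A = {a<..<b}" "B = {c<..<d}" by auto
      then have "A \<inter> B = (\<lambda>(a, b). {a<..<b}) (max a c, min b d)" by auto
      then show "A \<inter> B \<in> ?G" by blast
    qed
  next
    fix A assume "A \<in> sigma_sets UNIV ?G" "(\<integral>x. indicator A x * f x \<partial>lborel) = 0"
    then have A: "A \<in> sets borel" "(\<integral>x. indicator A x * f x \<partial>lborel) = 0" using sets_eq by auto
    have "(\<integral>x. indicator (UNIV - A) x * f x \<partial>lborel) = (\<integral>x. f x - indicator A x * f x \<partial>lborel)"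
      by (intro Bochner_Integration.integral_cong) (auto simp: indicator_def)
    then show "(\<integral>x. indicator (UNIV - A) x * f x \<partial>lborel) = 0"
      using A fi[OF A(1)] f total by simp
  next
    fix A :: "nat \<Rightarrow> real set"
    assume d: "disjoint_family A" and r: "range A \<subseteq> sigma_sets UNIV ?G"
      and z: "\<And>i. (\<integral>x. indicator (A i) x * f x \<partial>lborel) = 0"
    have s: "A i \<in> sets lborel" for i using r sets_eq by auto
    have "set_lebesgue_integral lborel (\<Union>i. A i) f = (\<Sum>i. set_lebesgue_integral lborel (A i) f)"
      using s d f fi[of "\<Union>i. A i"]
      by (intro lebesgue_integral_countable_add)
         (auto simp: disjoint_family_on_def set_integrable_def)
    then show "(\<integral>x. indicator (\<Union>i. A i) x * f x \<partial>lborel) = 0"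
      by (simp add: set_lebesgue_integral_def z)
  qed (use int in auto)
  have [measurable]: "f \<in> borel_measurable borel" using borel_measurable_integrable[OF f] by simp
  have pos: "{x. f x > 0} \<in> sets borel" and neg: "{x. f x < 0} \<in> sets borel" by measurable
  have "AE x in lborel. indicator {x. f x > 0} x * f x = 0"
    by (rule integral_nonneg_eq_0_iff_AE[THEN iffD1, OF fi[OF pos] _ zero[folded sets_eq, OF pos]])
       (auto simp: indicator_def)
  moreover have "AE x in lborel. - (indicator {x. f x < 0} x * f x) = 0"
    by (rule integral_nonneg_eq_0_iff_AE[THEN iffD1, OF Bochner_Integration.integrable_minus[OF fi[OF neg]]])
       (use zero[folded sets_eq, OF neg] in \<open>auto simp: indicator_def\<close>)
  ultimately show ?thesis
    by eventually_elim (auto simp: indicator_def split: if_splits)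
qed

text \<open>For a < b the quadratic is positive exactly on (a, b), and its truncated cube is C^2.
  For n >= 0 the exponential squeezes the values into [0, 1) and pushes them to 1 inside (a, b) as n
  grows: a C^2 approximation of the indicator of (a, b).\<close>

definition bump :: "real \<Rightarrow> real \<Rightarrow> real \<Rightarrow> real \<Rightarrow> real" where
  "bump n a b x = 1 - exp (- n * max 0 ((x - a) * (b - x)) ^ 3)"

text \<open>With q the quadratic and m its truncation at zero, the cube of m has derivative 3 m^2 q'
  and the square of m has derivative 2 m q', both continuous. The last conclusion makes v' vanish
  off (a, b) as well, so that v' can itself serve as a test function.\<close>

lemma bump_C2:
  obtains v' v'' where "\<And>x. (bump n a b has_real_derivative v' x) (at x)"
    "\<And>x. (v' has_real_derivative v'' x) (at x)" "continuous_on UNIV v''"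
    "\<And>x. (x - a) * (b - x) \<le> 0 \<Longrightarrow> v' x = 0"
proof -
  define q where "q x = (x - a) * (b - x)" for x
  define m where "m x = max 0 (q x)" for x
  have q: "(q has_real_derivative (a + b - 2 * x)) (at x)" for x
    unfolding q_def by (auto intro!: derivative_eq_intros)
  define r where "r x = m x ^ 3" for x
  define w where "w x = m x ^ 2" for x
  have r: "(r has_real_derivative 3 * w x * (a + b - 2 * x)) (at x)" for x
    using DERIV_chain2[OF max0_power_deriv[of 1] q, of x]
    unfolding r_def w_def m_def numeral_3_eq_3 One_nat_def by (simp add: power2_eq_square)
  have w: "(w has_real_derivative 2 * m x * (a + b - 2 * x)) (at x)" for x
    using DERIV_chain2[OF max0_power_deriv[of 0] q, of x]
    unfolding w_def m_def numeral_2_eq_2 One_nat_def by simp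
  have cont: "continuous_on UNIV m" "continuous_on UNIV w" "continuous_on UNIV r"
    unfolding r_def w_def m_def q_def by (intro continuous_intros)+
  have bump: "bump n a b = (\<lambda>x. 1 - exp (- n * r x))"
    by (auto simp: bump_def r_def m_def q_def)
  define v' where "v' x = n * (3 * w x * (a + b - 2 * x)) * exp (- n * r x)" for x
  define v'' where "v'' x = n * (3 * (2 * m x * (a + b - 2 * x)) * (a + b - 2 * x) + 3 * w x * (-2)) * exp (- n * r x)
     + n * (3 * w x * (a + b - 2 * x)) * (exp (- n * r x) * (- n * (3 * w x * (a + b - 2 * x))))" for x
  show thesis
  proof
    show "(bump n a b has_real_derivative v' x) (at x)" for x
      unfolding bump v'_def by (auto intro!: derivative_eq_intros r)
    show "(v' has_real_derivative v'' x) (at x)" for x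
      unfolding v'_def v''_def by (auto intro!: derivative_eq_intros w r simp: algebra_simps)
    show "continuous_on UNIV v''"
      unfolding v''_def by (intro continuous_intros cont)
  qed (auto simp: v'_def w_def m_def q_def)
qed

lemma quadratic_nonpos:
  fixes a b x :: real
  assumes "a < b" "x \<notin> {a<..<b}"
  shows "(x - a) * (b - x) \<le> 0"
proof (cases "x \<le> a")
  case True
  then show ?thesis using assms by (intro mult_nonpos_nonneg) auto
next
  case False
  then show ?thesis using assms by (intro mult_nonneg_nonpos) auto
qed

lemma bump_eq_0: "a < b \<Longrightarrow> x \<notin> {a<..<b} \<Longrightarrow> bump n a b x = 0"
  using quadratic_nonpos[of a b x] by (simp add: bump_def max_def)

lemma bump_bounds:
  assumes "n \<ge> 0"
  shows "\<bar>bump n a b x\<bar> \<le> 1"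
proof -
  have "exp (- n * max 0 ((x - a) * (b - x)) ^ 3) \<le> 1" using assms by simp
  then show ?thesis
    unfolding bump_def using exp_gt_zero[of "- n * max 0 ((x - a) * (b - x)) ^ 3"] by linarith
qed

text \<open>The bumps sit on intervals shrunk by \<open>e n\<close>, which keeps their supports
  strictly inside (a, b). At a fixed point of (a, b) the truncated cube has a positive limit, so n
  times it tends to infinity and the exponential to 0; outside (a, b) every bump is zero.\<close>

lemma bump_tendsto_indicator:
  fixes a b :: real
  assumes "a < b"
  defines "e \<equiv> \<lambda>n. (b - a) / (real n + 3)"
  shows "(\<lambda>n. bump (real n) (a + e n) (b - e n) x) \<longlonglongrightarrow> indicator {a<..<b} x"
proof -
  have e: "e \<longlonglongrightarrow> 0" unfolding e_def
    by (intro tendsto_divide_0[OF tendsto_const] filterlim_at_top_imp_at_infinity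
        filterlim_tendsto_add_at_top_iff[THEN iffD2, of "\<lambda>_. 3" 3, simplified add.commute] filterlim_real_sequentially) simp_all
  \<comment> \<open>The summand 3 in the denominator keeps 2 * \<open>e n\<close> below b - a
    already for n = 0, so no shrunken interval is empty.\<close>
  have e0: "0 < e n" "2 * e n < b - a" for n
    using assms(1) mult_strict_right_mono[OF assms(1), of "real n + 1"] by (auto simp: e_def field_simps add_pos_nonneg)
  show ?thesis
  proof (cases "x \<in> {a<..<b}")
    case True
    then have p: "(x - a) * (b - x) > 0" by simp
    have "(\<lambda>n. max 0 ((x - (a + e n)) * (b - e n - x)) ^ 3) \<longlonglongrightarrow> max 0 ((x - (a + 0)) * (b - 0 - x)) ^ 3"
      by (intro tendsto_intros e)
    moreover have "max 0 ((x - (a + 0)) * (b - 0 - x)) ^ 3 > 0" using p by (simp add: max_def)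
    ultimately have "filterlim (\<lambda>n. max 0 ((x - (a + e n)) * (b - e n - x)) ^ 3 * real n) at_top sequentially"
      by (rule filterlim_tendsto_pos_mult_at_top) (rule filterlim_real_sequentially)
    then have "filterlim (\<lambda>n. - (max 0 ((x - (a + e n)) * (b - e n - x)) ^ 3 * real n)) at_bot sequentially"
      by (simp add: filterlim_uminus_at_top)
    then have "(\<lambda>n. exp (- (max 0 ((x - (a + e n)) * (b - e n - x)) ^ 3 * real n))) \<longlonglongrightarrow> 0"
      by (rule filterlim_compose[OF exp_at_bot])
    then have "(\<lambda>n. 1 - exp (- (max 0 ((x - (a + e n)) * (b - e n - x)) ^ 3 * real n))) \<longlonglongrightarrow> 1 - 0"
      by (intro tendsto_intros)
    then show ?thesis using True by (simp add: bump_def mult.commute)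
  next
    case False
    have "bump (real n) (a + e n) (b - e n) x = 0" for n
      by (rule bump_eq_0) (use e0[of n] False in auto)
    then show ?thesis using False by simp
  qed
qed

text \<open>Fundamental lemma of the calculus of variations: if f annihilated all bumps, dominated
  convergence would make every interval integral of its zero extension vanish, and f would be null.
  That v' is a test function too allows the pairing of \<open>px\<close> with v' to become one of p
  with v''.\<close>

lemma ex_C2_test_function:
  fixes f :: "real \<Rightarrow> real"
  assumes "L > 0" and f: "f \<in> l2_space (ivl L)" and nz: "\<not> (AE x in ivl L. f x = 0)"
  obtains v v' v'' where "\<And>x. (v has_real_derivative v' x) (at x)"
    "\<And>x. (v' has_real_derivative v'' x) (at x)" "continuous_on UNIV v''"
    "v \<in> test_funs L" "v' \<in> test_funs L" "(\<integral>x. f x * v x \<partial>ivl L) \<noteq> 0"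
proof -
  have fi: "integrable lborel (\<lambda>x. indicator {0<..<L} x * f x)"
    using integrable_l2_space[OF finite_measure_ivl f] by (simp add: integrable_ivl_iff)
  have meas: "(\<lambda>x. indicator {0<..<L} x * f x) \<in> borel_measurable borel"
    using borel_measurable_integrable[OF fi] by simp
  have "\<exists>a b n. 0 < a \<and> a < b \<and> b < L \<and> (\<integral>x. f x * bump (real n) a b x \<partial>ivl L) \<noteq> 0"
  proof (rule ccontr)
    assume "\<not> ?thesis"
    then have zero: "\<And>a b n. 0 < a \<Longrightarrow> a < b \<Longrightarrow> b < L \<Longrightarrow> (\<integral>x. f x * bump (real n) a b x \<partial>ivl L) = 0"
      by blast
    have "(\<integral>x. indicator {a<..<b} x * (indicator {0<..<L} x * f x) \<partial>lborel) = 0" for a b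
    proof (cases "max a 0 < min b L")
      case False
      then have "indicator {a<..<b} x * (indicator {0<..<L} x * f x) = 0" for x
        by (auto simp: indicator_def)
      then show ?thesis by (simp only: Bochner_Integration.integral_zero)
    next
      case True
      \<comment> \<open>Clipping (a, b) to (0, L) does not change the integral, and the shrunken
        bumps on (c, d) are supported compactly inside (0, L), where the assumption
        \<open>zero\<close> applies.\<close>
      define c d where "c = max a 0" and "d = min b L"
      have cd: "c < d" "0 \<le> c" "d \<le> L" using True by (auto simp: c_def d_def)
      define e where "e n = (d - c) / (real n + 3)" for n
      have e0: "0 < e n" "2 * e n < d - c" for n
        using cd(1) mult_strict_right_mono[OF cd(1), of "real n + 1"] by (auto simp: e_def field_simps add_pos_nonneg)
      have [measurable]: "bump n a b \<in> borel_measurable borel" for n a b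
        unfolding bump_def by measurable
      note [measurable] = meas
      have "(\<lambda>n. \<integral>x. bump (real n) (c + e n) (d - e n) x * (indicator {0<..<L} x * f x) \<partial>lborel)
         \<longlonglongrightarrow> (\<integral>x. indicator {c<..<d} x * (indicator {0<..<L} x * f x) \<partial>lborel)"
      proof (rule integral_dominated_convergence[where w = "\<lambda>x. norm (indicator {0<..<L} x * f x)"])
        show "AE x in lborel. (\<lambda>n. bump (real n) (c + e n) (d - e n) x * (indicator {0<..<L} x * f x))
          \<longlonglongrightarrow> indicator {c<..<d} x * (indicator {0<..<L} x * f x)"
          unfolding e_def by (intro AE_I2 tendsto_intros bump_tendsto_indicator cd)
        show "AE x in lborel. norm (bump (real n) (c + e n) (d - e n) x * (indicator {0<..<L} x * f x))
            \<le> norm (indicator {0<..<L} x * f x)" for n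
          by (intro AE_I2) (simp add: abs_mult mult_left_le_one_le bump_bounds)
        show "integrable lborel (\<lambda>x. norm (indicator {0<..<L} x * f x))"
          by (rule integrable_norm) (rule fi)
      qed auto
      moreover have "(\<integral>x. bump (real n) (c + e n) (d - e n) x * (indicator {0<..<L} x * f x) \<partial>lborel) = 0" for n
        using zero[of "c + e n" "d - e n" n] e0[of n] cd by (simp add: integral_ivl mult_ac)
      moreover have "indicator {c<..<d} x * (indicator {0<..<L} x * f x) = indicator {a<..<b} x * (indicator {0<..<L} x * f x)" for x
        by (auto simp: indicator_def c_def d_def)
      ultimately show ?thesis by (simp add: LIMSEQ_const_iff)
    qed
    then have "AE x in lborel. indicator {0<..<L} x * f x = 0"
      by (intro AE_eq_0_of_interval_integrals fi)
    then have "AE x in ivl L. f x = 0"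
      unfolding AE_ivl_iff by eventually_elim (auto simp: indicator_def)
    with nz show False by simp
  qed
  then obtain a b n where ab: "0 < a" "a < b" "b < L"
    and nz: "(\<integral>x. f x * bump (real n) a b x \<partial>ivl L) \<noteq> 0" by blast
  obtain v' v'' where v: "\<And>x. (bump (real n) a b has_real_derivative v' x) (at x)"
    "\<And>x. (v' has_real_derivative v'' x) (at x)" "continuous_on UNIV v''"
    "\<And>x. (x - a) * (b - x) \<le> 0 \<Longrightarrow> v' x = 0" 
    using bump_C2[of "real n" a b] by blast
  have cv: "continuous_on UNIV v'" by (rule DERIV_continuous_on) (use v in auto)
  show thesis
  proof (rule that[OF v(1-3) _ _ nz])
    show "bump (real n) a b \<in> test_funs L"
      by (rule test_funsI(1)[OF v(1) cv ab(1,3)]) (auto intro!: bump_eq_0 ab)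
    show "v' \<in> test_funs L"
      by (rule test_funsI(1)[OF v(2,3) ab(1,3)]) (auto intro!: v(4) quadratic_nonpos ab)
  qed
qed

section \<open>The tested weak formulation\<close>

lemma pair_sigma_finite_ivl: "pair_sigma_finite (ivl T) (ivl L)"
  using finite_measure_ivl[of T] finite_measure_ivl[of L]
  by (intro pair_sigma_finite.intro finite_measure.axioms)

lemma finite_measure_pair_ivl: "finite_measure (ivl T \<Otimes>\<^sub>M ivl L)"
  by (rule finite_measure_pair_measure[OF finite_measure_ivl finite_measure_ivl])

lemma bounded_measurable_l2_space:
  assumes "finite_measure M" "f \<in> borel_measurable M" "\<And>x. x \<in> space M \<Longrightarrow> \<bar>f x\<bar> \<le> B"
  shows "f \<in> l2_space M"
proof -
  interpret finite_measure M by fact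
  have "integrable M (\<lambda>x. (f x)\<^sup>2)"
  proof (rule integrable_const_bound[where B = "B\<^sup>2"])
    show "AE x in M. norm ((f x)\<^sup>2) \<le> B\<^sup>2"
    proof (rule AE_I2)
      fix x assume "x \<in> space M"
      then have "\<bar>f x\<bar> ^ 2 \<le> B ^ 2" using assms(3) by (intro power_mono) auto
      then show "norm ((f x)\<^sup>2) \<le> B\<^sup>2" by simp
    qed
  qed (use assms in auto)
  then show ?thesis using assms by (auto simp: l2_space_def)
qed

lemma tensor_l2_space:
  fixes \<alpha> \<beta> :: "real \<Rightarrow> real"
  assumes "continuous_on UNIV \<alpha>" "continuous_on UNIV \<beta>"
  shows "(\<lambda>(t, x). \<alpha> t * \<beta> x) \<in> l2_space (ivl T \<Otimes>\<^sub>M ivl L)"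
proof -
  obtain A where A: "A > 0" "\<And>t. t \<in> {0<..<T} \<Longrightarrow> \<bar>\<alpha> t\<bar> \<le> A" using continuous_bounded_ivl[OF assms(1)] by metis
  obtain B where B: "B > 0" "\<And>t. t \<in> {0<..<L} \<Longrightarrow> \<bar>\<beta> t\<bar> \<le> B" using continuous_bounded_ivl[OF assms(2)] by metis
  have [measurable]: "\<alpha> \<in> borel_measurable (ivl T)" "\<beta> \<in> borel_measurable (ivl L)"
    using assms by (auto intro: continuous_measurable_ivl)
  show ?thesis
    by (rule bounded_measurable_l2_space[where B = "A * B", OF finite_measure_pair_ivl])
       (use A B in \<open>auto simp: space_pair_measure abs_mult intro!: mult_mono\<close>)
qed

lemma L2L2_tensor_integrable:
  fixes \<alpha> \<beta> :: "real \<Rightarrow> real"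
  assumes "u \<in> L2L2 T L" "continuous_on UNIV \<alpha>" "continuous_on UNIV \<beta>"
  shows "integrable (ivl T \<Otimes>\<^sub>M ivl L) (\<lambda>(t, x). u t x * \<beta> x * \<alpha> t)"
  using integrable_mult_l2_space[OF assms(1)[unfolded L2L2_def mem_Collect_eq] tensor_l2_space[OF assms(2,3)]]
  by (simp add: case_prod_unfold mult_ac)

text \<open>Splitting a spatial integral into summands needs each of them integrable, as
  non-integrable functions have integral 0 by convention. Square integrable slices guarantee this at
  almost every time.\<close>

lemma L2L2_section_l2:
  assumes "u \<in> L2L2 T L"
  shows "AE t in ivl T. u t \<in> l2_space (ivl L)"
proof -
  interpret pair_sigma_finite "ivl T" "ivl L" by (rule pair_sigma_finite_ivl)
  have "AE t in ivl T. integrable (ivl L) (\<lambda>x. (u t x)\<^sup>2)"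
    using assms by (intro AE_integrable_fst) (auto simp: L2L2_def l2_space_def case_prod_unfold)
  moreover have "AE t in ivl T. u t \<in> borel_measurable (ivl L)"
  proof (rule AE_I2)
    fix t assume "t \<in> space (ivl T)"
    then show "u t \<in> borel_measurable (ivl L)"
      using assms measurable_Pair2[of "\<lambda>(t, x). u t x" "ivl T" "ivl L" borel t]
      by (simp add: L2L2_def l2_space_def)
  qed
  ultimately show ?thesis by eventually_elim (simp add: l2_space_def)
qed

lemma L2L2_time_integrable:
  fixes \<alpha> \<beta> :: "real \<Rightarrow> real"
  assumes "u \<in> L2L2 T L" "continuous_on UNIV \<alpha>" "continuous_on UNIV \<beta>"
  shows "integrable (ivl T) (\<lambda>t. (\<integral>x. u t x * \<beta> x \<partial>ivl L) * \<alpha> t)"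
proof -
  interpret pair_sigma_finite "ivl T" "ivl L" by (rule pair_sigma_finite_ivl)
  show ?thesis using integrable_fst[OF L2L2_tensor_integrable[OF assms]] by simp
qed

lemma L2L2_integral_swap:
  fixes \<alpha> \<beta> :: "real \<Rightarrow> real"
  assumes "u \<in> L2L2 T L" "continuous_on UNIV \<alpha>" "continuous_on UNIV \<beta>"
  shows "(\<integral>x. (\<integral>t. u t x * \<alpha> t \<partial>ivl T) * \<beta> x \<partial>ivl L) = (\<integral>t. (\<integral>x. u t x * \<beta> x \<partial>ivl L) * \<alpha> t \<partial>ivl T)"
proof -
  interpret pair_sigma_finite "ivl T" "ivl L" by (rule pair_sigma_finite_ivl)
  have "(\<integral>x. (\<integral>t. u t x * \<alpha> t \<partial>ivl T) * \<beta> x \<partial>ivl L) = (\<integral>x. (\<integral>t. u t x * \<beta> x * \<alpha> t \<partial>ivl T) \<partial>ivl L)"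
    by (simp add: mult.assoc mult.commute[of "\<alpha> _"] flip: integral_mult_left_zero)
  also have "\<dots> = (\<integral>t. (\<integral>x. u t x * \<beta> x * \<alpha> t \<partial>ivl L) \<partial>ivl T)"
    by (rule Fubini_integral[OF L2L2_tensor_integrable[OF assms]])
  finally show ?thesis by simp
qed

lemma AE_test_deriv:
  assumes "has_dx T L u ux" "\<beta> \<in> test_funs L"
  shows "AE t in ivl T. (\<integral>x. u t x * deriv \<beta> x \<partial>ivl L) = - (\<integral>x. ux t x * \<beta> x \<partial>ivl L)"
  using assms by (auto simp: has_dx_def has_weak_deriv_def)

text \<open>The exceptional null sets lie in x for \<open>has_dt\<close> and in t for
  \<open>has_dx\<close>. Testing u with the product of \<phi>'(t) and \<beta>'(x) and exchanging the
  integrals reconciles the two, which identifies the weak time derivative of the tested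
  strain.\<close>

lemma weak_mixed_derivatives_commute:
  assumes u: "u \<in> L2L2 T L" "ut \<in> L2L2 T L" "has_dt T L u ut" "has_dx T L u ux" "has_dx T L ut uxt"
    and \<phi>: "\<phi> \<in> test_funs T" and \<beta>: "\<beta> \<in> test_funs L"
  shows "(\<integral>t. (\<integral>x. ux t x * \<beta> x \<partial>ivl L) * deriv \<phi> t \<partial>ivl T)
       = - (\<integral>t. (\<integral>x. uxt t x * \<beta> x \<partial>ivl L) * \<phi> t \<partial>ivl T)"
proof -
  have c: "continuous_on UNIV \<phi>" "continuous_on UNIV (deriv \<phi>)" "continuous_on UNIV \<beta>" "continuous_on UNIV (deriv \<beta>)"
    using test_funs_props[OF \<phi>] test_funs_props[OF \<beta>] by auto
  have ux: "ux \<in> L2L2 T L" "uxt \<in> L2L2 T L" using u by (auto simp: has_dx_def)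
  have "(\<integral>t. (\<integral>x. u t x * deriv \<beta> x \<partial>ivl L) * deriv \<phi> t \<partial>ivl T)
     = (\<integral>x. (\<integral>t. u t x * deriv \<phi> t \<partial>ivl T) * deriv \<beta> x \<partial>ivl L)"
    by (rule L2L2_integral_swap[symmetric]) (use u c in auto)
  also have "\<dots> = (\<integral>x. - ((\<integral>t. ut t x * \<phi> t \<partial>ivl T) * deriv \<beta> x) \<partial>ivl L)"
  proof (rule integral_cong_AE)
    interpret pair_sigma_finite "ivl T" "ivl L" by (rule pair_sigma_finite_ivl)
    have [measurable]: "deriv \<beta> \<in> borel_measurable (ivl L)" using c by (auto intro: continuous_measurable_ivl)
    \<comment> \<open>The constant spatial weight 1 lets Fubini deliver measurability in x of the
      bare time integral.\<close>
    have 1: "(\<lambda>x. \<integral>t. u t x * deriv \<phi> t \<partial>ivl T) \<in> borel_measurable (ivl L)"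
      using borel_measurable_integrable[OF integrable_snd[OF L2L2_tensor_integrable[OF u(1) c(2) continuous_on_const[of _ 1]]]]
      by simp
    have 2: "(\<lambda>x. \<integral>t. ut t x * \<phi> t \<partial>ivl T) \<in> borel_measurable (ivl L)"
      using borel_measurable_integrable[OF integrable_snd[OF L2L2_tensor_integrable[OF u(2) c(1) continuous_on_const[of _ 1]]]]
      by simp
    show "(\<lambda>x. (\<integral>t. u t x * deriv \<phi> t \<partial>ivl T) * deriv \<beta> x) \<in> borel_measurable (ivl L)"
      "(\<lambda>x. - ((\<integral>t. ut t x * \<phi> t \<partial>ivl T) * deriv \<beta> x)) \<in> borel_measurable (ivl L)"
      using 1 2 by measurable
    show "AE x in ivl L. (\<integral>t. u t x * deriv \<phi> t \<partial>ivl T) * deriv \<beta> x = - ((\<integral>t. ut t x * \<phi> t \<partial>ivl T) * deriv \<beta> x)"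
      using u(3) \<phi> unfolding has_dt_def by (auto elim!: eventually_mono)
  qed
  also have "\<dots> = - (\<integral>t. (\<integral>x. ut t x * deriv \<beta> x \<partial>ivl L) * \<phi> t \<partial>ivl T)"
    using L2L2_integral_swap[OF u(2) c(1) c(4)] by simp
  finally have main: "(\<integral>t. (\<integral>x. u t x * deriv \<beta> x \<partial>ivl L) * deriv \<phi> t \<partial>ivl T)
     = - (\<integral>t. (\<integral>x. ut t x * deriv \<beta> x \<partial>ivl L) * \<phi> t \<partial>ivl T)" .
  \<comment> \<open>Both sides of \<open>main\<close> are rewritten with the weak space derivatives;
    each contributes a minus sign, and the two cancel.\<close>
  have "(\<integral>t. (\<integral>x. u t x * deriv \<beta> x \<partial>ivl L) * deriv \<phi> t \<partial>ivl T)
      = (\<integral>t. - ((\<integral>x. ux t x * \<beta> x \<partial>ivl L) * deriv \<phi> t) \<partial>ivl T)"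
    using AE_test_deriv[OF u(4) \<beta>] u ux c
    by (intro integral_cong_AE borel_measurable_integrable Bochner_Integration.integrable_minus L2L2_time_integrable)
       (auto elim!: eventually_mono)
  moreover have "(\<integral>t. (\<integral>x. ut t x * deriv \<beta> x \<partial>ivl L) * \<phi> t \<partial>ivl T)
      = (\<integral>t. - ((\<integral>x. uxt t x * \<beta> x \<partial>ivl L) * \<phi> t) \<partial>ivl T)"
    using AE_test_deriv[OF u(5) \<beta>] u ux c
    by (intro integral_cong_AE borel_measurable_integrable Bochner_Integration.integrable_minus L2L2_time_integrable)
       (auto elim!: eventually_mono)
  ultimately show ?thesis using main by simp
qed

text \<open>Up to sign, \<phi>' - a \<phi> is the formal adjoint of f' + a f applied to \<phi>.
  Hence the pairing of f with s reduces to one of p with \<phi>; the compact support of \<phi>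
  leaves no boundary terms in time, and only p remains on the right-hand side.\<close>

lemma weak_solution_tested:
  fixes v v' v'' :: "real \<Rightarrow> real"
  assumes sol: "weak_solution T L He Hv k chi s (u, p)" and L: "L > 0" and Hv: "Hv \<noteq> 0"
    and v: "\<And>x. (v has_real_derivative v' x) (at x)" "\<And>x. (v' has_real_derivative v'' x) (at x)"
      "continuous_on UNIV v''" "v \<in> test_funs L" "v' \<in> test_funs L"
    and \<phi>: "\<phi> \<in> test_funs T"
    and s: "s = (\<lambda>t. deriv \<phi> t - He / Hv * \<phi> t)"
    and c: "c = (\<integral>x. chi x * v x \<partial>ivl L)"
  shows "c * (\<integral>t. (s t)\<^sup>2 \<partial>ivl T)
    = (\<integral>(t, x). p t x * (s t * (v x / Hv - k * v'' x) + \<phi> t * (He / Hv * v x / Hv)) \<partial>(ivl T \<Otimes>\<^sub>M ivl L))"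
proof -
  obtain ut ux uxt px where
    u: "u \<in> L2V0 T L" "ut \<in> L2V0 T L" "has_dt T L u ut" "has_dx T L u ux" "has_dx T L ut uxt"
    and p: "p \<in> L2V0 T L" "has_dx T L p px"
    and eqs: "AE t in ivl T. \<forall>v vx. v \<in> V0 L \<and> vx \<in> l2_space (ivl L) \<and> has_weak_deriv L v vx \<longrightarrow>
           (\<integral>x. (Hv * uxt t x + He * ux t x - p t x) * vx x \<partial>ivl L) = 0 \<and>
           (\<integral>x. uxt t x * v x \<partial>ivl L) + (\<integral>x. k * px t x * vx x \<partial>ivl L)
             = (\<integral>x. s t * chi x * v x \<partial>ivl L)"
    using sol by (auto simp: weak_solution_def H1V0_def)
  have l2: "u \<in> L2L2 T L" "ut \<in> L2L2 T L" "p \<in> L2L2 T L" "ux \<in> L2L2 T L" "uxt \<in> L2L2 T L" "px \<in> L2L2 T L"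
    using u p by (auto simp: L2V0_def has_dx_def)
  note t\<phi> = test_funs_props[OF \<phi>] and tv = test_funs_props[OF v(4)] and tv' = test_funs_props[OF v(5)]
  have cv: "continuous_on UNIV v" "continuous_on UNIV v'" using tv tv' by auto
  have v'': "deriv v' = v''" using v(2) by (auto simp: fun_eq_iff intro!: DERIV_imp_deriv)
  have cs: "continuous_on UNIV s" unfolding s by (intro continuous_intros t\<phi>)
  obtain V where V: "\<And>x. (V has_real_derivative v x) (at x)" "V 0 = 0"
    using ex_antideriv[OF cv(1)] by blast
  \<comment> \<open>Tested strain, tested strain rate and two pressure moments. In these terms the
    two equations become \<open>h = P / Hv - a * f\<close> and
    \<open>s * c = h - k * q\<close>.\<close>
  define f where "f t = (\<integral>x. ux t x * v x \<partial>ivl L)" for t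
  define h where "h t = (\<integral>x. uxt t x * v x \<partial>ivl L)" for t
  define P where "P t = (\<integral>x. p t x * v x \<partial>ivl L)" for t
  define q where "q t = (\<integral>x. p t x * v'' x \<partial>ivl L)" for t
  have i: "integrable (ivl T) (\<lambda>t. f t * \<alpha> t)" "integrable (ivl T) (\<lambda>t. h t * \<alpha> t)"
    "integrable (ivl T) (\<lambda>t. P t * \<alpha> t)" "integrable (ivl T) (\<lambda>t. q t * \<alpha> t)"
    if "continuous_on UNIV \<alpha>" for \<alpha> :: "real \<Rightarrow> real"
    unfolding f_def h_def P_def q_def using that cv v(3) l2 by (auto intro!: L2L2_time_integrable)
  have fh: "(\<integral>t. f t * deriv \<phi> t \<partial>ivl T) = - (\<integral>t. h t * \<phi> t \<partial>ivl T)"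
    unfolding f_def h_def by (rule weak_mixed_derivatives_commute[OF l2(1,2) u(3-5) \<phi> v(4)])
  have e1: "AE t in ivl T. h t = P t / Hv - He / Hv * f t"
    using eqs L2L2_section_l2[OF l2(3)] L2L2_section_l2[OF l2(4)] L2L2_section_l2[OF l2(5)]
  proof eventually_elim
    case (elim t)
    \<comment> \<open>The stress equation is tested with V, so that its derivative v appears as the
      weight.\<close>
    have m: "V \<in> V0 L" "v \<in> l2_space (ivl L)" "has_weak_deriv L V v"
      using V cv L by (auto intro!: V0_C1 l2_space_continuous has_weak_deriv_C1)
    note i = integrable_mult_l2_space[OF elim(2) m(2)] integrable_mult_l2_space[OF elim(3) m(2)] integrable_mult_l2_space[OF elim(4) m(2)]
    have "0 = (\<integral>x. (Hv * uxt t x + He * ux t x - p t x) * v x \<partial>ivl L)"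
      using elim(1) m by simp
    also have "\<dots> = (\<integral>x. Hv * (uxt t x * v x) + He * (ux t x * v x) - p t x * v x \<partial>ivl L)"
      by (simp add: algebra_simps)
    also have "\<dots> = Hv * h t + He * f t - P t"
      using i by (simp add: h_def f_def P_def)
    finally show ?case using Hv by (simp add: field_simps)
  qed
  have e2: "AE t in ivl T. s t * c = h t - k * q t"
    using eqs AE_test_deriv[OF p(2) v(5)]
  proof eventually_elim
    case (elim t)
    have m: "v \<in> V0 L" "v' \<in> l2_space (ivl L)" "has_weak_deriv L v v'"
      using v cv L tv by (auto intro!: V0_C1 l2_space_continuous has_weak_deriv_C1)
    have "h t + (\<integral>x. k * px t x * v' x \<partial>ivl L) = (\<integral>x. s t * chi x * v x \<partial>ivl L)"
      using elim(1) m by (simp add: h_def)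
    \<comment> \<open>The mass equation is tested with v itself; since v' is compactly supported,
      the weak derivative moves from p to v' without a boundary term.\<close>
    moreover have "(\<integral>x. k * px t x * v' x \<partial>ivl L) = - k * q t"
      using elim(2) v'' by (simp add: q_def mult.assoc)
    ultimately show ?case by (simp add: c mult.assoc)
  qed
  define a where "a = He / Hv"
  have h\<phi>: "(\<integral>t. h t * \<phi> t \<partial>ivl T) = (\<integral>t. 1 / Hv * (P t * \<phi> t) - a * (f t * \<phi> t) \<partial>ivl T)"
  proof (intro integral_cong_AE borel_measurable_integrable)
    show "AE t in ivl T. h t * \<phi> t = 1 / Hv * (P t * \<phi> t) - a * (f t * \<phi> t)"
      using e1 by eventually_elim (simp add: a_def left_diff_distrib)
  qed (auto intro!: i t\<phi>)
  have "c * (\<integral>t. (s t)\<^sup>2 \<partial>ivl T) = (\<integral>t. (s t * c) * s t \<partial>ivl T)"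
    by (simp add: power2_eq_square mult_ac flip: integral_mult_left_zero integral_mult_right_zero)
  also have "\<dots> = (\<integral>t. 1 / Hv * (P t * s t) - k * (q t * s t) - a * (f t * s t) \<partial>ivl T)"
  proof (intro integral_cong_AE borel_measurable_integrable)
    show "AE t in ivl T. s t * c * s t = 1 / Hv * (P t * s t) - k * (q t * s t) - a * (f t * s t)"
      using e1 e2
    proof eventually_elim
      case (elim t)
      have "s t * c * s t = (P t / Hv - a * f t - k * q t) * s t"
        unfolding elim(2) by (simp add: elim(1) a_def)
      then show ?case by (simp add: left_diff_distrib)
    qed
    show "integrable (ivl T) (\<lambda>t. s t * c * s t)"
      by (intro integrable_continuous_ivl continuous_intros cs)
    show "integrable (ivl T) (\<lambda>t. 1 / Hv * (P t * s t) - k * (q t * s t) - a * (f t * s t))"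
      by (intro Bochner_Integration.integrable_diff integrable_mult_right i cs)
  qed
  also have "\<dots> = (\<integral>t. 1 / Hv * (P t * s t) - k * (q t * s t) - a * (f t * deriv \<phi> t) + a\<^sup>2 * (f t * \<phi> t) \<partial>ivl T)"
    by (intro Bochner_Integration.integral_cong) (auto simp: s a_def algebra_simps power2_eq_square)
  also have "\<dots> = 1 / Hv * (\<integral>t. P t * s t \<partial>ivl T) - k * (\<integral>t. q t * s t \<partial>ivl T)
      - a * (\<integral>t. f t * deriv \<phi> t \<partial>ivl T) + a\<^sup>2 * (\<integral>t. f t * \<phi> t \<partial>ivl T)"
    using i[OF cs] i[OF t\<phi>(2)] i[OF t\<phi>(3)] by simp
  \<comment> \<open>Multiplied by -a, this produces -a^2 times the integral of f \<phi>, which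
    cancels the last summand above, and leaves a / \<open>Hv\<close> times the integral of P
    \<phi>.\<close>
  also have "(\<integral>t. f t * deriv \<phi> t \<partial>ivl T) = a * (\<integral>t. f t * \<phi> t \<partial>ivl T) - 1 / Hv * (\<integral>t. P t * \<phi> t \<partial>ivl T)"
    unfolding fh h\<phi> using i[OF t\<phi>(3)] by simp
  finally have "c * (\<integral>t. (s t)\<^sup>2 \<partial>ivl T) = 1 / Hv * (\<integral>t. P t * s t \<partial>ivl T) - k * (\<integral>t. q t * s t \<partial>ivl T)
     + a / Hv * (\<integral>t. P t * \<phi> t \<partial>ivl T)" 
    by (simp add: algebra_simps power2_eq_square)
  moreover have tensor: "(\<integral>t. (\<integral>x. p t x * \<beta> x \<partial>ivl L) * \<alpha> t \<partial>ivl T) = (\<integral>(t, x). p t x * \<beta> x * \<alpha> t \<partial>(ivl T \<Otimes>\<^sub>M ivl L))"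
    if "continuous_on UNIV \<alpha>" "continuous_on UNIV \<beta>" for \<alpha> \<beta> :: "real \<Rightarrow> real"
  proof -
    interpret pair_sigma_finite "ivl T" "ivl L" by (rule pair_sigma_finite_ivl)
    show ?thesis using integral_fst[OF L2L2_tensor_integrable[OF l2(3) that]] by simp
  qed
  let ?M = "ivl T \<Otimes>\<^sub>M ivl L"
  define F1 F2 F3 where "F1 = (\<lambda>(t, x). p t x * v x * s t)" and "F2 = (\<lambda>(t, x). p t x * v'' x * s t)"
    and "F3 = (\<lambda>(t, x). p t x * v x * \<phi> t)"
  have F: "integrable ?M F1" "integrable ?M F2" "integrable ?M F3"
    unfolding F1_def F2_def F3_def by (intro L2L2_tensor_integrable l2 cs cv v(3) t\<phi>)+
  have "(\<lambda>(t, x). p t x * (s t * (v x / Hv - k * v'' x) + \<phi> t * (He / Hv * v x / Hv)))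
    = (\<lambda>z. 1 / Hv * F1 z - k * F2 z + a / Hv * F3 z)"
    by (auto simp: fun_eq_iff F1_def F2_def F3_def a_def algebra_simps)
  then have "(\<integral>(t, x). p t x * (s t * (v x / Hv - k * v'' x) + \<phi> t * (He / Hv * v x / Hv)) \<partial>?M)
    = 1 / Hv * (\<integral>z. F1 z \<partial>?M) - k * (\<integral>z. F2 z \<partial>?M) + a / Hv * (\<integral>z. F3 z \<partial>?M)"
    using F by simp
  moreover have "(\<integral>z. F1 z \<partial>?M) = (\<integral>t. P t * s t \<partial>ivl T)" "(\<integral>z. F2 z \<partial>?M) = (\<integral>t. q t * s t \<partial>ivl T)"
    "(\<integral>z. F3 z \<partial>?M) = (\<integral>t. P t * \<phi> t \<partial>ivl T)"
    unfolding P_def q_def F1_def F2_def F3_def tensor[OF cs cv(1)] tensor[OF cs v(3)] tensor[OF t\<phi>(3) cv(1)]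
    by (rule refl)+
  ultimately show ?thesis by simp
qed

section \<open>Quadratic growth\<close>

lemma l2_norm_nonneg [simp]: "l2_norm M f \<ge> 0"
  by (simp add: l2_norm_def)

lemma l2_norm_cmult: "l2_norm M (\<lambda>x. c * f x) = \<bar>c\<bar> * l2_norm M f"
  by (simp add: l2_norm_def power_mult_distrib real_sqrt_mult)

lemma l2_linear_cmult:
  assumes "l2_linear M F" "f \<in> l2_space M"
  shows "F (\<lambda>x. c * f x) = c * F f"
  using assms(1)[unfolded l2_linear_def, rule_format, OF assms(2) assms(2), of c 0] by simp

text \<open>The remainder bound carries a free factor B so that one argument covers the functional
  itself, with B = 1, and its derivative evaluated at \<psi>, with B the norm of \<psi>. Along the
  line every increment is a multiple of \<psi>, so its norm is proportional to |y - \<tau>|.\<close>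

lemma frechet_deriv_along_line:
  fixes \<psi> :: "'a \<Rightarrow> real" and F :: "('a \<Rightarrow> real) \<Rightarrow> real"
  assumes \<psi>: "\<psi> \<in> l2_space M"
    and D: "\<And>h. F' (\<lambda>x. h * \<psi> x) = h * F' \<psi>"
    and lim: "\<And>\<epsilon>. \<epsilon> > 0 \<Longrightarrow> \<exists>d>0. \<forall>h\<in>l2_space M. l2_norm M h < d \<longrightarrow>
        \<bar>F (\<lambda>x. \<tau> * \<psi> x + h x) - F (\<lambda>x. \<tau> * \<psi> x) - F' h\<bar> \<le> \<epsilon> * l2_norm M h * B"
  shows "((\<lambda>\<tau>. F (\<lambda>x. \<tau> * \<psi> x)) has_real_derivative F' \<psi>) (at \<tau>)"
  unfolding has_field_derivative_def has_derivative_at_alt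
proof (intro conjI allI impI bounded_linear_mult_right)
  fix e :: real assume e: "e > 0"
  \<comment> \<open>The summand 1 keeps K positive even when \<psi> has norm zero.\<close>
  define K where "K = l2_norm M \<psi> * \<bar>B\<bar> + 1"
  have K: "K > 0" unfolding K_def by (intro add_nonneg_pos mult_nonneg_nonneg) auto
  then obtain d where d: "d > 0" and bd: "\<And>h. h \<in> l2_space M \<Longrightarrow> l2_norm M h < d \<Longrightarrow>
        \<bar>F (\<lambda>x. \<tau> * \<psi> x + h x) - F (\<lambda>x. \<tau> * \<psi> x) - F' h\<bar> \<le> e / K * l2_norm M h * B"
    using lim[of "e / K"] e by auto
  show "\<exists>d>0. \<forall>y. norm (y - \<tau>) < d \<longrightarrow>
     norm (F (\<lambda>x. y * \<psi> x) - F (\<lambda>x. \<tau> * \<psi> x) - F' \<psi> * (y - \<tau>)) \<le> e * norm (y - \<tau>)"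
  proof (intro exI[of _ "d / (l2_norm M \<psi> + 1)"] conjI allI impI)
    have pos: "l2_norm M \<psi> + 1 > 0" by (simp add: add_nonneg_pos)
    then show "d / (l2_norm M \<psi> + 1) > 0" using d by simp
    fix y :: real assume y: "norm (y - \<tau>) < d / (l2_norm M \<psi> + 1)"
    then have y': "\<bar>y - \<tau>\<bar> * (l2_norm M \<psi> + 1) < d" using pos by (simp add: field_simps)
    have n: "l2_norm M (\<lambda>x. (y - \<tau>) * \<psi> x) = \<bar>y - \<tau>\<bar> * l2_norm M \<psi>" by (rule l2_norm_cmult)
    also have "\<dots> \<le> \<bar>y - \<tau>\<bar> * (l2_norm M \<psi> + 1)" by (intro mult_left_mono) auto
    finally have "l2_norm M (\<lambda>x. (y - \<tau>) * \<psi> x) < d" using y' by simp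
    moreover have "(\<lambda>x. \<tau> * \<psi> x + (y - \<tau>) * \<psi> x) = (\<lambda>x. y * \<psi> x)"
      by (auto simp: fun_eq_iff left_diff_distrib)
    ultimately have "\<bar>F (\<lambda>x. y * \<psi> x) - F (\<lambda>x. \<tau> * \<psi> x) - F' \<psi> * (y - \<tau>)\<bar> \<le> e / K * (\<bar>y - \<tau>\<bar> * l2_norm M \<psi>) * B"
      using bd[OF l2_space_cmult[OF \<psi>], of "y - \<tau>"] unfolding D n by (simp only: mult.commute[of "F' \<psi>"])
    also have "\<dots> = e / K * \<bar>y - \<tau>\<bar> * (l2_norm M \<psi> * B)" by simp
    also have "\<dots> \<le> e / K * \<bar>y - \<tau>\<bar> * K"
    proof (intro mult_left_mono)
      have "l2_norm M \<psi> * B \<le> l2_norm M \<psi> * \<bar>B\<bar>" by (intro mult_left_mono) auto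
      then show "l2_norm M \<psi> * B \<le> K" by (simp add: K_def)
    qed (use e K in auto)
    also have "\<dots> = e * \<bar>y - \<tau>\<bar>" using K by simp
    finally show "norm (F (\<lambda>x. y * \<psi> x) - F (\<lambda>x. \<tau> * \<psi> x) - F' \<psi> * (y - \<tau>)) \<le> e * norm (y - \<tau>)"
      by simp
  qed
qed

text \<open>Second-order Taylor estimate at 0 along \<psi> from two mean value theorems. B bounds
  the derivative at 0 in the dual norm, and the Hessian enters only on the diagonal.\<close>

lemma hessian_L1_bounded_growth:
  assumes "hessian_L1_bounded T j"
  obtains B C where "\<And>\<psi>. \<psi> \<in> l2_space (ivl T) \<Longrightarrow>
    j \<psi> \<le> j (\<lambda>_. 0) + B * l2_norm (ivl T) \<psi> + C * (l1_norm (ivl T) \<psi>)\<^sup>2"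
proof -
  define M where "M = ivl T"
  obtain D2 D C where D: "l2_frechet_deriv M j D"
    and D2: "\<And>w. w \<in> l2_space M \<Longrightarrow> l2_bounded_bilinear M (D2 w)"
      "\<And>w \<epsilon>. w \<in> l2_space M \<Longrightarrow> \<epsilon> > 0 \<Longrightarrow> \<exists>d>0. \<forall>h\<in>l2_space M. l2_norm M h < d \<longrightarrow>
          (\<forall>\<phi>\<in>l2_space M. \<bar>D (\<lambda>x. w x + h x) \<phi> - D w \<phi> - D2 w h \<phi>\<bar>
             \<le> \<epsilon> * l2_norm M h * l2_norm M \<phi>)"
    and C: "\<And>w \<psi> \<phi>. w \<in> l2_space M \<Longrightarrow> \<psi> \<in> l2_space M \<Longrightarrow> \<phi> \<in> l2_space M \<Longrightarrow>
        \<bar>D2 w \<psi> \<phi>\<bar> \<le> C * l1_norm M \<psi> * l1_norm M \<phi>"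
    using assms unfolding hessian_L1_bounded_def l2_second_frechet_deriv_def M_def[symmetric] by blast
  have Dj: "\<And>w \<epsilon>. w \<in> l2_space M \<Longrightarrow> \<epsilon> > 0 \<Longrightarrow> \<exists>d>0. \<forall>h\<in>l2_space M. l2_norm M h < d \<longrightarrow>
        \<bar>j (\<lambda>x. w x + h x) - j w - D w h\<bar> \<le> \<epsilon> * l2_norm M h"
    using D unfolding l2_frechet_deriv_def by blast
  have zero: "(\<lambda>_. 0) \<in> l2_space M" by (simp add: l2_space_def)
  obtain B where B: "\<And>f. f \<in> l2_space M \<Longrightarrow> \<bar>D (\<lambda>_. 0) f\<bar> \<le> B * l2_norm M f"
    using D zero unfolding l2_frechet_deriv_def l2_bounded_linear_def by blast
  show thesis
  proof (rule that[of B C, folded M_def])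
    fix \<psi> assume \<psi>: "\<psi> \<in> l2_space M"
    have w: "(\<lambda>x. \<tau> * \<psi> x) \<in> l2_space M" for \<tau> using \<psi> by (rule l2_space_cmult)
    have lin: "l2_linear M (D (\<lambda>x. \<tau> * \<psi> x))" for \<tau>
      using D w unfolding l2_frechet_deriv_def l2_bounded_linear_def by blast
    have lin2: "l2_linear M (\<lambda>g. D2 (\<lambda>x. \<tau> * \<psi> x) g \<psi>)" for \<tau>
      using D2(1)[OF w] \<psi> unfolding l2_bounded_bilinear_def by blast
    have d1: "((\<lambda>\<tau>. j (\<lambda>x. \<tau> * \<psi> x)) has_real_derivative D (\<lambda>x. \<tau> * \<psi> x) \<psi>) (at \<tau>)" for \<tau>
    proof (rule frechet_deriv_along_line[where F = j and F' = "D (\<lambda>x. \<tau> * \<psi> x)" and B = 1, OF \<psi>])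
      show "D (\<lambda>x. \<tau> * \<psi> x) (\<lambda>x. h * \<psi> x) = h * D (\<lambda>x. \<tau> * \<psi> x) \<psi>" for h
        by (rule l2_linear_cmult[OF lin \<psi>])
      fix \<epsilon> :: real assume "\<epsilon> > 0"
      then show "\<exists>d>0. \<forall>h\<in>l2_space M. l2_norm M h < d \<longrightarrow>
        \<bar>j (\<lambda>x. \<tau> * \<psi> x + h x) - j (\<lambda>x. \<tau> * \<psi> x) - D (\<lambda>x. \<tau> * \<psi> x) h\<bar> \<le> \<epsilon> * l2_norm M h * 1"
        using Dj[OF w] unfolding mult_1_right by meson
    qed
    have d2: "((\<lambda>\<tau>. D (\<lambda>x. \<tau> * \<psi> x) \<psi>) has_real_derivative D2 (\<lambda>x. \<tau> * \<psi> x) \<psi> \<psi>) (at \<tau>)" for \<tau>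
    proof (rule frechet_deriv_along_line[where F = "\<lambda>w. D w \<psi>" and
          F' = "\<lambda>g. D2 (\<lambda>x. \<tau> * \<psi> x) g \<psi>" and B = "l2_norm M \<psi>", OF \<psi>])
      show "D2 (\<lambda>x. \<tau> * \<psi> x) (\<lambda>x. h * \<psi> x) \<psi> = h * D2 (\<lambda>x. \<tau> * \<psi> x) \<psi> \<psi>" for h
        by (rule l2_linear_cmult[OF lin2 \<psi>])
      fix \<epsilon> :: real assume "\<epsilon> > 0"
      then show "\<exists>d>0. \<forall>h\<in>l2_space M. l2_norm M h < d \<longrightarrow>
        \<bar>D (\<lambda>x. \<tau> * \<psi> x + h x) \<psi> - D (\<lambda>x. \<tau> * \<psi> x) \<psi> - D2 (\<lambda>x. \<tau> * \<psi> x) h \<psi>\<bar> \<le> \<epsilon> * l2_norm M h * l2_norm M \<psi>"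
        using D2(2)[OF w] \<psi> by meson
    qed
    obtain \<xi> :: real where \<xi>: "0 < \<xi>" "\<xi> < 1" "j (\<lambda>x. 1 * \<psi> x) - j (\<lambda>x. 0 * \<psi> x) = (1 - 0) * D (\<lambda>x. \<xi> * \<psi> x) \<psi>"
      using MVT2[where f = "\<lambda>\<tau>. j (\<lambda>x. \<tau> * \<psi> x)" and f' = "\<lambda>\<tau>. D (\<lambda>x. \<tau> * \<psi> x) \<psi>", OF zero_less_one d1] by blast
    \<comment> \<open>The second mean value theorem acts on [0, \<xi>]; the length \<xi> < 1 is then
      estimated by 1.\<close>
    obtain \<eta> where \<eta>: "D (\<lambda>x. \<xi> * \<psi> x) \<psi> - D (\<lambda>x. 0 * \<psi> x) \<psi> = (\<xi> - 0) * D2 (\<lambda>x. \<eta> * \<psi> x) \<psi> \<psi>"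
      using MVT2[where f = "\<lambda>\<tau>. D (\<lambda>x. \<tau> * \<psi> x) \<psi>" and f' = "\<lambda>\<tau>. D2 (\<lambda>x. \<tau> * \<psi> x) \<psi> \<psi>", OF \<xi>(1) d2] by blast
    have C': "\<bar>D2 (\<lambda>x. \<eta> * \<psi> x) \<psi> \<psi>\<bar> \<le> C * (l1_norm M \<psi>)\<^sup>2"
      using C[OF w \<psi> \<psi>] by (simp add: power2_eq_square mult.assoc)
    have "\<xi> * D2 (\<lambda>x. \<eta> * \<psi> x) \<psi> \<psi> \<le> \<xi> * \<bar>D2 (\<lambda>x. \<eta> * \<psi> x) \<psi> \<psi>\<bar>"
      using \<xi> by (intro mult_left_mono) auto
    also have "\<dots> \<le> 1 * \<bar>D2 (\<lambda>x. \<eta> * \<psi> x) \<psi> \<psi>\<bar>"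
      using \<xi> by (intro mult_right_mono) auto
    finally have "\<xi> * D2 (\<lambda>x. \<eta> * \<psi> x) \<psi> \<psi> \<le> C * (l1_norm M \<psi>)\<^sup>2" using C' by simp
    then show "j \<psi> \<le> j (\<lambda>_. 0) + B * l2_norm M \<psi> + C * (l1_norm M \<psi>)\<^sup>2"
      using \<xi>(3) \<eta> B[OF \<psi>] by simp
  qed
qed

section \<open>Square integrals over the space-time rectangle\<close>

lemma L2L2_norm_sq:
  assumes "r \<in> L2L2 T L"
  shows "(L2L2_norm T L r)\<^sup>2 = (\<integral>(t, x). (r t x)\<^sup>2 \<partial>(ivl T \<Otimes>\<^sub>M ivl L))"
proof -
  interpret pair_sigma_finite "ivl T" "ivl L" by (rule pair_sigma_finite_ivl)
  have "integrable (ivl T \<Otimes>\<^sub>M ivl L) (\<lambda>(t, x). (r t x)\<^sup>2)"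
    using assms by (simp add: L2L2_def l2_space_def case_prod_unfold)
  from integral_fst[OF this] show ?thesis
    by (simp add: L2L2_norm_def l2_norm_sq)
qed

lemma L2L2_add: "u \<in> L2L2 T L \<Longrightarrow> v \<in> L2L2 T L \<Longrightarrow> (\<lambda>t x. u t x + v t x) \<in> L2L2 T L"
  using l2_space_add[of "\<lambda>(t, x). u t x" _ "\<lambda>(t, x). v t x"] by (simp add: L2L2_def case_prod_unfold)

lemma L2L2_diff: "u \<in> L2L2 T L \<Longrightarrow> v \<in> L2L2 T L \<Longrightarrow> (\<lambda>t x. u t x - v t x) \<in> L2L2 T L"
  using l2_space_diff[of "\<lambda>(t, x). u t x" _ "\<lambda>(t, x). v t x"] by (simp add: L2L2_def case_prod_unfold)

text \<open>The nonnegative square of \<rho> |f| - |g|, integrated. The weight \<rho> stays free so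
  that the source can later be absorbed into the left-hand side.\<close>

lemma integral_mult_le_young:
  fixes f g :: "'a \<Rightarrow> real"
  assumes "f \<in> l2_space M" "g \<in> l2_space M" "\<rho> > 0"
  shows "\<bar>\<integral>x. f x * g x \<partial>M\<bar> \<le> \<rho> / 2 * (\<integral>x. (f x)\<^sup>2 \<partial>M) + 1 / (2 * \<rho>) * (\<integral>x. (g x)\<^sup>2 \<partial>M)"
proof -
  have sq: "integrable M (\<lambda>x. (f x)\<^sup>2)" "integrable M (\<lambda>x. (g x)\<^sup>2)" using assms by (auto simp: l2_space_def)
  have fg: "integrable M (\<lambda>x. f x * g x)" by (rule integrable_mult_l2_space) fact+
  have "\<bar>\<integral>x. f x * g x \<partial>M\<bar> \<le> (\<integral>x. \<bar>f x * g x\<bar> \<partial>M)" by (rule integral_abs_bound)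
  also have "\<dots> \<le> (\<integral>x. \<rho> / 2 * (f x)\<^sup>2 + 1 / (2 * \<rho>) * (g x)\<^sup>2 \<partial>M)"
  proof (rule integral_mono)
    fix x
    have "0 \<le> (\<rho> * \<bar>f x\<bar> - \<bar>g x\<bar>)\<^sup>2" by simp
    also have "\<dots> = \<rho>\<^sup>2 * (f x)\<^sup>2 - 2 * \<rho> * \<bar>f x * g x\<bar> + (g x)\<^sup>2"
      by (simp add: power2_diff power_mult_distrib abs_mult)
    finally have "2 * \<rho> * \<bar>f x * g x\<bar> \<le> \<rho>\<^sup>2 * (f x)\<^sup>2 + (g x)\<^sup>2" by simp
    then show "\<bar>f x * g x\<bar> \<le> \<rho> / 2 * (f x)\<^sup>2 + 1 / (2 * \<rho>) * (g x)\<^sup>2"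
      using assms(3) by (simp add: field_simps power2_eq_square)
  qed (use sq fg in auto)
  also have "\<dots> = \<rho> / 2 * (\<integral>x. (f x)\<^sup>2 \<partial>M) + 1 / (2 * \<rho>) * (\<integral>x. (g x)\<^sup>2 \<partial>M)"
    using sq by simp
  finally show ?thesis .
qed

lemma tensor_integral_sq_le:
  fixes s \<phi> \<beta> \<gamma> :: "real \<Rightarrow> real"
  assumes L: "L > 0" and c: "continuous_on UNIV s" "continuous_on UNIV \<phi>" "continuous_on UNIV \<beta>" "continuous_on UNIV \<gamma>"
    and K: "\<And>x. x \<in> {0<..<L} \<Longrightarrow> \<bar>\<beta> x\<bar> \<le> K" "\<And>x. x \<in> {0<..<L} \<Longrightarrow> \<bar>\<gamma> x\<bar> \<le> K"
  shows "(\<integral>(t, x). (s t * \<beta> x + \<phi> t * \<gamma> x)\<^sup>2 \<partial>(ivl T \<Otimes>\<^sub>M ivl L))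
    \<le> 2 * K\<^sup>2 * L * ((\<integral>t. (s t)\<^sup>2 \<partial>ivl T) + (\<integral>t. (\<phi> t)\<^sup>2 \<partial>ivl T))"
proof -
  interpret pair_sigma_finite "ivl T" "ivl L" by (rule pair_sigma_finite_ivl)
  have int1: "integrable (ivl T \<Otimes>\<^sub>M ivl L) (\<lambda>(t, x). (s t * \<beta> x + \<phi> t * \<gamma> x)\<^sup>2)"
    using l2_space_add[OF tensor_l2_space[OF c(1,3)] tensor_l2_space[OF c(2,4)], of T L]
    by (simp add: l2_space_def case_prod_unfold)
  have "integrable (ivl T \<Otimes>\<^sub>M ivl L) (\<lambda>z. 2 * K\<^sup>2 * ((case z of (t, x) \<Rightarrow> s t * 1)\<^sup>2 + (case z of (t, x) \<Rightarrow> \<phi> t * 1)\<^sup>2))"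
    using tensor_l2_space[OF c(1) continuous_on_const[of _ 1], of T L] tensor_l2_space[OF c(2) continuous_on_const[of _ 1], of T L]
    by (intro integrable_mult_right Bochner_Integration.integrable_add) (auto simp: l2_space_def)
  then have int2: "integrable (ivl T \<Otimes>\<^sub>M ivl L) (\<lambda>(t, x). 2 * K\<^sup>2 * ((s t)\<^sup>2 + (\<phi> t)\<^sup>2))"
    by (simp add: case_prod_unfold)
  have "(\<integral>(t, x). (s t * \<beta> x + \<phi> t * \<gamma> x)\<^sup>2 \<partial>(ivl T \<Otimes>\<^sub>M ivl L)) \<le> (\<integral>(t, x). 2 * K\<^sup>2 * ((s t)\<^sup>2 + (\<phi> t)\<^sup>2) \<partial>(ivl T \<Otimes>\<^sub>M ivl L))"
  proof (rule integral_mono[OF int1 int2], clarsimp simp: space_pair_measure)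
    fix t x assume x: "0 < x" "x < L"
    have b: "(\<beta> x)\<^sup>2 \<le> K\<^sup>2" "(\<gamma> x)\<^sup>2 \<le> K\<^sup>2"
      using power_mono[OF K(1)[of x], of 2] power_mono[OF K(2)[of x], of 2] x by simp_all
    have "(s t * \<beta> x + \<phi> t * \<gamma> x)\<^sup>2 \<le> 2 * ((s t * \<beta> x)\<^sup>2 + (\<phi> t * \<gamma> x)\<^sup>2)"
      using sum_squares_bound[of "s t * \<beta> x" "\<phi> t * \<gamma> x"] by (simp add: power2_sum)
    also have "\<dots> = 2 * ((s t)\<^sup>2 * (\<beta> x)\<^sup>2 + (\<phi> t)\<^sup>2 * (\<gamma> x)\<^sup>2)" by (simp add: power_mult_distrib)
    also have "\<dots> \<le> 2 * ((s t)\<^sup>2 * K\<^sup>2 + (\<phi> t)\<^sup>2 * K\<^sup>2)"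
      using b by (intro mult_left_mono add_mono) auto
    finally show "(s t * \<beta> x + \<phi> t * \<gamma> x)\<^sup>2 \<le> 2 * K\<^sup>2 * ((s t)\<^sup>2 + (\<phi> t)\<^sup>2)" by (simp add: algebra_simps)
  qed
  also have "\<dots> = (\<integral>t. (\<integral>x. 2 * K\<^sup>2 * ((s t)\<^sup>2 + (\<phi> t)\<^sup>2) \<partial>ivl L) \<partial>ivl T)"
    by (rule integral_fst[OF int2, symmetric])
  also have "\<dots> = 2 * K\<^sup>2 * L * ((\<integral>t. (s t)\<^sup>2 \<partial>ivl T) + (\<integral>t. (\<phi> t)\<^sup>2 \<partial>ivl T))"
    using L l2_space_continuous[OF c(1), of T] l2_space_continuous[OF c(2), of T]
    by (simp add: measure_ivl l2_space_def)
  finally show ?thesis .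
qed

section \<open>Oscillating sources\<close>

text \<open>Scaling: a bump of height 1 compressed to width of order 1 / n has slope of order n on a
  set of measure of order 1 / n. The L1 norm of its slope stays bounded while the squared L2 norm
  grows like n.\<close>

lemma ex_steep_test_function:
  fixes T n :: real
  assumes T: "T > 0" and n: "n > 2 / T"
  obtains \<phi> where "\<phi> \<in> test_funs T" "\<And>t. \<bar>\<phi> t\<bar> \<le> 1"
    "(\<integral>t. \<bar>deriv \<phi> t\<bar> \<partial>ivl T) \<le> 8" "n / 8 \<le> (\<integral>t. (deriv \<phi> t)\<^sup>2 \<partial>ivl T)"
proof -
  have n0: "n > 0" using n T by (meson divide_pos_pos less_trans zero_less_numeral)
  have nT: "1 / n < T / 2" using n T n0 by (simp add: field_simps)
  \<comment> \<open>The bump is centred at T / 2, and n > 2 / T puts its support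
    [t0 - 1 / n, t0 + 1 / n] inside (0, T).\<close>
  define t0 where "t0 = T / 2"
  define y where "y t = 1 - n\<^sup>2 * (t - t0)\<^sup>2" for t
  define \<phi> where "\<phi> t = max 0 (y t) ^ 2" for t
  define d where "d t = - (4 * n * (n * (t - t0) * max 0 (y t)))" for t
  have y: "(y has_real_derivative - 2 * n\<^sup>2 * (t - t0)) (at t)" for t
    unfolding y_def by (auto intro!: derivative_eq_intros)
  have "(\<phi> has_real_derivative d t) (at t)" for t
    using DERIV_chain2[OF max0_power_deriv[of 0] y, of t]
    unfolding \<phi>_def d_def numeral_2_eq_2 One_nat_def by (simp add: algebra_simps)
  moreover have cd: "continuous_on UNIV d"
    unfolding d_def y_def by (intro continuous_intros)
  moreover have supp: "y t \<le> 0" if "t \<notin> {t0 - 1 / n..t0 + 1 / n}" for t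
  proof -
    have "1 / n \<le> \<bar>t - t0\<bar>" using that by auto
    then have "1 \<le> n * \<bar>t - t0\<bar>" using n0 by (simp add: field_simps)
    then have "1 ^ 2 \<le> (n * \<bar>t - t0\<bar>) ^ 2" by (intro power_mono) auto
    then show ?thesis by (simp add: y_def power_mult_distrib)
  qed
  moreover have "\<phi> t = 0" if "t \<notin> {t0 - 1 / n..t0 + 1 / n}" for t
    using supp[OF that] by (simp add: \<phi>_def)
  moreover have "0 < t0 - 1 / n" "t0 + 1 / n < T" using nT by (auto simp: t0_def)
  ultimately have \<phi>: "\<phi> \<in> test_funs T" "deriv \<phi> = d"
    using test_funsI[of \<phi> d "t0 - 1 / n" "t0 + 1 / n" T] by blast+
  have [measurable]: "d \<in> borel_measurable borel" using cd by (rule borel_measurable_continuous_onI)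
  have y1: "max 0 (y t) \<le> 1" for t by (simp add: y_def)
  \<comment> \<open>On the support both n |t - t0| and the truncated y are at most 1. With support
    length 2 / n this yields the bound 8.\<close>
  have d_le: "\<bar>d t\<bar> \<le> 4 * n * indicator {t0 - 1 / n..t0 + 1 / n} t" for t
  proof (cases "t \<in> {t0 - 1 / n..t0 + 1 / n}")
    case True
    then have "\<bar>t - t0\<bar> \<le> 1 / n" by (auto simp: abs_le_iff)
    then have "n * \<bar>t - t0\<bar> \<le> 1" using n0 by (simp add: field_simps)
    then have "n * \<bar>t - t0\<bar> * max 0 (y t) \<le> 1 * 1" using n0 y1 by (intro mult_mono) auto
    then have "4 * n * (n * \<bar>t - t0\<bar> * max 0 (y t)) \<le> 4 * n * 1"
      using n0 by (intro mult_left_mono) auto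
    moreover have "\<bar>d t\<bar> = 4 * n * (n * \<bar>t - t0\<bar> * max 0 (y t))"
      unfolding d_def abs_minus_cancel abs_mult using n0 by simp
    ultimately show ?thesis using True by simp
  next
    case False
    then show ?thesis using supp[OF False] by (simp add: d_def)
  qed
  \<comment> \<open>Where n (t - t0) lies in [1/4, 1/2] one has y >= 3/4, so |d| >= 4 n * 1/4 * 3/4
    = 3 n / 4. The interval has length 1 / (4 n), giving 9 n / 64, which exceeds n / 8.\<close>
  have d_ge: "9 / 16 * n\<^sup>2 * indicator {t0 + 1 / (4 * n)..t0 + 1 / (2 * n)} t \<le> (d t)\<^sup>2" for t
  proof (cases "t \<in> {t0 + 1 / (4 * n)..t0 + 1 / (2 * n)}")
    case True
    then have t: "1 / 4 \<le> n * (t - t0)" "n * (t - t0) \<le> 1 / 2" using n0 by (auto simp: field_simps)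
    have "(n * (t - t0))\<^sup>2 \<le> (1 / 2)\<^sup>2" by (rule power_mono) (use t in auto)
    then have "3 / 4 \<le> y t" by (simp add: y_def power_mult_distrib power_divide)
    then have "1 / 4 * (3 / 4) \<le> n * (t - t0) * max 0 (y t)" using t by (intro mult_mono) auto
    then have "4 * n * (1 / 4 * (3 / 4)) \<le> 4 * n * (n * (t - t0) * max 0 (y t))"
      using n0 by (intro mult_left_mono) auto
    then have "(4 * n * (1 / 4 * (3 / 4)))\<^sup>2 \<le> (4 * n * (n * (t - t0) * max 0 (y t)))\<^sup>2"
      using n0 by (intro power_mono) auto
    moreover have "(4 * n * (1 / 4 * (3 / 4)))\<^sup>2 = 9 / 16 * n\<^sup>2" by (simp add: power2_eq_square)
    ultimately show ?thesis using True unfolding d_def power2_minus by simp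
  qed simp
  have 1: "(\<integral>t. \<bar>d t\<bar> \<partial>ivl T) \<le> 8"
  proof -
    have "(\<integral>t. \<bar>d t\<bar> \<partial>ivl T) = (\<integral>t. indicator {0<..<T} t * \<bar>d t\<bar> \<partial>lborel)" by (rule integral_ivl)
    also have "\<dots> \<le> (\<integral>t. 4 * n * indicator {t0 - 1 / n..t0 + 1 / n} t \<partial>lborel)"
    proof (rule integral_mono)
      show "integrable lborel (\<lambda>t. indicator {0<..<T} t * \<bar>d t\<bar>)"
        unfolding integrable_ivl_iff[symmetric] by (intro integrable_continuous_ivl continuous_intros cd)
      show "integrable lborel (\<lambda>t. 4 * n * indicator {t0 - 1 / n..t0 + 1 / n} t)"
        by (intro integrable_mult_right integrable_real_indicator) (auto simp: emeasure_lborel_Icc_eq)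
      show "indicator {0<..<T} t * \<bar>d t\<bar> \<le> 4 * n * indicator {t0 - 1 / n..t0 + 1 / n} t" for t
        using d_le[of t] n0 by (cases "t \<in> {0<..<T}") auto
    qed
    also have "\<dots> = 8" using n0 by (simp add: measure_lborel_Icc field_simps)
    finally show ?thesis .
  qed
  have 2: "n / 8 \<le> (\<integral>t. (d t)\<^sup>2 \<partial>ivl T)"
  proof -
    have m: "1 / (4 * n) \<le> 1 / (2 * n)" using n0 by (simp add: field_simps)
    have "n / 8 \<le> 9 / 64 * n" using n0 by simp
    also have "\<dots> = (\<integral>t. 9 / 16 * n\<^sup>2 * indicator {t0 + 1 / (4 * n)..t0 + 1 / (2 * n)} t \<partial>lborel)"
      using n0 m by (simp add: measure_lborel_Icc field_simps power2_eq_square)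
    also have "\<dots> \<le> (\<integral>t. indicator {0<..<T} t * (d t)\<^sup>2 \<partial>lborel)"
    proof (rule integral_mono)
      show "integrable lborel (\<lambda>t. indicator {0<..<T} t * (d t)\<^sup>2)"
        unfolding integrable_ivl_iff[symmetric] by (intro integrable_continuous_ivl continuous_intros cd)
      show "integrable lborel (\<lambda>t. 9 / 16 * n\<^sup>2 * indicator {t0 + 1 / (4 * n)..t0 + 1 / (2 * n)} t)"
        by (intro integrable_mult_right integrable_real_indicator) (auto simp: emeasure_lborel_Icc_eq)
      fix t
      have "1 / (2 * n) < T / 2" "1 / (4 * n) > 0" using nT n0 T by (auto simp: field_simps)
      then have "t \<in> {0<..<T}" if "t \<in> {t0 + 1 / (4 * n)..t0 + 1 / (2 * n)}"
        using that T by (auto simp: t0_def)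
      then show "9 / 16 * n\<^sup>2 * indicator {t0 + 1 / (4 * n)..t0 + 1 / (2 * n)} t \<le> indicator {0<..<T} t * (d t)\<^sup>2"
        using d_ge[of t] by (cases "t \<in> {t0 + 1 / (4 * n)..t0 + 1 / (2 * n)}") auto
    qed
    also have "\<dots> = (\<integral>t. (d t)\<^sup>2 \<partial>ivl T)" by (rule integral_ivl[symmetric])
    finally show ?thesis .
  qed
  have "\<bar>\<phi> t\<bar> \<le> 1" for t
    using power_mono[OF y1[of t], of 2] by (simp add: \<phi>_def)
  then show thesis using that \<phi> 1 2 by metis
qed

text \<open>The tested identity pairs p with functions whose L2 size is controlled by s and \<phi>,
  so Young's inequality allows the s part to be absorbed. The constant \<rho> depends on v but not
  on \<phi>, hence it is uniform over the steep sources.\<close>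

lemma pressure_controls_source:
  fixes T L He Hv k :: real
  assumes "L > 0" "Hv \<noteq> 0" "chi \<in> l2_space (ivl L)" "\<not> (AE x in ivl L. chi x = 0)"
  obtains \<rho> where "\<rho> > 0"
    "\<And>\<phi> u p. \<phi> \<in> test_funs T \<Longrightarrow>
      weak_solution T L He Hv k chi (\<lambda>t. deriv \<phi> t - He / Hv * \<phi> t) (u, p) \<Longrightarrow>
      (\<integral>t. (deriv \<phi> t - He / Hv * \<phi> t)\<^sup>2 \<partial>ivl T)
        \<le> \<rho> * (\<integral>(t, x). (p t x)\<^sup>2 \<partial>(ivl T \<Otimes>\<^sub>M ivl L)) + (\<integral>t. (\<phi> t)\<^sup>2 \<partial>ivl T)"
proof -
  obtain v v' v'' where v: "\<And>x. (v has_real_derivative v' x) (at x)"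
    "\<And>x. (v' has_real_derivative v'' x) (at x)" "continuous_on UNIV v''"
    "v \<in> test_funs L" "v' \<in> test_funs L" and nz: "(\<integral>x. chi x * v x \<partial>ivl L) \<noteq> 0"
    using ex_C2_test_function[OF assms(1,3,4)] by blast
  define c where "c = (\<integral>x. chi x * v x \<partial>ivl L)"
  define \<beta> where "\<beta> x = v x / Hv - k * v'' x" for x
  define \<gamma> where "\<gamma> x = He / Hv * v x / Hv" for x
  have cont: "continuous_on UNIV \<beta>" "continuous_on UNIV \<gamma>"
    unfolding \<beta>_def \<gamma>_def using test_funs_props(3)[OF v(4)] v(3) assms(2)
    by (auto intro!: continuous_intros)
  obtain K1 where K1: "K1 > 0" "\<And>x. x \<in> {0<..<L} \<Longrightarrow> \<bar>\<beta> x\<bar> \<le> K1"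
    using continuous_bounded_ivl[OF cont(1), of L] by metis
  obtain K2 where K2: "K2 > 0" "\<And>x. x \<in> {0<..<L} \<Longrightarrow> \<bar>\<gamma> x\<bar> \<le> K2"
    using continuous_bounded_ivl[OF cont(2), of L] by metis
  define K where "K = max K1 K2"
  have K: "K > 0" "\<And>x. x \<in> {0<..<L} \<Longrightarrow> \<bar>\<beta> x\<bar> \<le> K" "\<And>x. x \<in> {0<..<L} \<Longrightarrow> \<bar>\<gamma> x\<bar> \<le> K"
    using K1 K2 unfolding K_def by force+
  define Q where "Q = 2 * K\<^sup>2 * L"
  have Q: "Q > 0" using K(1) assms(1) by (simp add: Q_def)
  have c: "\<bar>c\<bar> > 0" using nz by (simp add: c_def)
  show thesis
  \<comment> \<open>With Young weight Q / |c| the term S + \<Phi> receives the coefficient |c| / 2.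
    Half of |c| S on the left absorbs the S part; doubling and dividing by |c| leaves the factor Q /
    c^2 in front of P and 1 in front of \<Phi>.\<close>
  proof (rule that[of "Q / \<bar>c\<bar> / \<bar>c\<bar>"])
    show "Q / \<bar>c\<bar> / \<bar>c\<bar> > 0" by (intro divide_pos_pos Q c)
    fix \<phi> u p
    assume \<phi>: "\<phi> \<in> test_funs T" and sol: "weak_solution T L He Hv k chi (\<lambda>t. deriv \<phi> t - He / Hv * \<phi> t) (u, p)"
    define s where "s = (\<lambda>t. deriv \<phi> t - He / Hv * \<phi> t)"
    define S where "S = (\<integral>t. (s t)\<^sup>2 \<partial>ivl T)"
    define \<Phi> where "\<Phi> = (\<integral>t. (\<phi> t)\<^sup>2 \<partial>ivl T)"
    define P where "P = (\<integral>(t, x). (p t x)\<^sup>2 \<partial>(ivl T \<Otimes>\<^sub>M ivl L))"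
    have cs: "continuous_on UNIV s" "continuous_on UNIV \<phi>"
      unfolding s_def using test_funs_props[OF \<phi>] assms(2) by (auto intro!: continuous_intros)
    have p: "(\<lambda>(t, x). p t x) \<in> l2_space (ivl T \<Otimes>\<^sub>M ivl L)"
      using sol by (auto simp: weak_solution_def L2V0_def L2L2_def)
    have m: "(\<lambda>(t, x). s t * \<beta> x + \<phi> t * \<gamma> x) \<in> l2_space (ivl T \<Otimes>\<^sub>M ivl L)"
      using l2_space_add[OF tensor_l2_space[OF cs(1) cont(1)] tensor_l2_space[OF cs(2) cont(2)], of T L]
      by (simp add: case_prod_unfold)
    have "c * S = (\<integral>(t, x). p t x * (s t * \<beta> x + \<phi> t * \<gamma> x) \<partial>(ivl T \<Otimes>\<^sub>M ivl L))"
      unfolding S_def \<beta>_def \<gamma>_def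
      by (rule weak_solution_tested[OF sol[folded s_def] assms(1,2) v \<phi> s_def c_def])
    also have "\<bar>\<dots>\<bar> \<le> Q / \<bar>c\<bar> / 2 * P + 1 / (2 * (Q / \<bar>c\<bar>)) * (\<integral>(t, x). (s t * \<beta> x + \<phi> t * \<gamma> x)\<^sup>2 \<partial>(ivl T \<Otimes>\<^sub>M ivl L))"
      using integral_mult_le_young[OF p m, of "Q / \<bar>c\<bar>"] Q c by (simp add: case_prod_unfold P_def)
    also have "\<dots> \<le> Q / \<bar>c\<bar> / 2 * P + 1 / (2 * (Q / \<bar>c\<bar>)) * (Q * (S + \<Phi>))"
      unfolding Q_def S_def \<Phi>_def
      by (intro add_left_mono mult_left_mono tensor_integral_sq_le assms(1) cs cont K)
         (use Q c in \<open>auto simp: Q_def\<close>)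
    also have "1 / (2 * (Q / \<bar>c\<bar>)) * (Q * (S + \<Phi>)) = \<bar>c\<bar> / 2 * (S + \<Phi>)"
      using Q c by simp
    finally have "\<bar>c * S\<bar> \<le> Q / \<bar>c\<bar> / 2 * P + \<bar>c\<bar> / 2 * (S + \<Phi>)" by simp
    moreover have "S \<ge> 0" by (simp add: S_def)
    ultimately have "\<bar>c\<bar> * S \<le> Q / \<bar>c\<bar> * P + \<bar>c\<bar> * \<Phi>" by (simp add: abs_mult field_simps)
    then have "S \<le> (Q / \<bar>c\<bar> * P + \<bar>c\<bar> * \<Phi>) / \<bar>c\<bar>"
      using c by (simp add: pos_le_divide_eq mult.commute)
    also have "\<dots> = Q / \<bar>c\<bar> / \<bar>c\<bar> * P + \<Phi>" using c by (simp add: add_divide_distrib)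
    finally show "(\<integral>t. (deriv \<phi> t - He / Hv * \<phi> t)\<^sup>2 \<partial>ivl T)
        \<le> Q / \<bar>c\<bar> / \<bar>c\<bar> * (\<integral>(t, x). (p t x)\<^sup>2 \<partial>(ivl T \<Otimes>\<^sub>M ivl L)) + (\<integral>t. (\<phi> t)\<^sup>2 \<partial>ivl T)"
      by (simp add: S_def s_def P_def \<Phi>_def)
  qed
qed

section \<open>Contradiction along steep sources\<close>

theorem theorem5p7:
  fixes T L lam_e mu_e lam_v mu_v \<delta> k lam :: real
    and chi :: "real \<Rightarrow> real"
    and G :: "(real \<Rightarrow> real) \<Rightarrow> (real \<Rightarrow> real \<Rightarrow> real) \<times> (real \<Rightarrow> real \<Rightarrow> real)"
    and u0 p0 ud pd :: "real \<Rightarrow> real \<Rightarrow> real"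
  assumes "T > 0" and "L > 0"
    and "lam_e > 0" and "mu_e > 0" and "lam_v > 0" and "mu_v > 0"
    and "\<delta> > 0" and "k > 0" and "lam = 0"
    and "chi \<in> l2_space (ivl L)" and "\<not> (AE x in ivl L. chi x = 0)"
    and "ud \<in> L2L2 T L" and "pd \<in> L2L2 T L"
    and "u0 \<in> H1V0 T L" and "p0 \<in> L2V0 T L"
    and "\<And>s. s \<in> l2_space (ivl T) \<Longrightarrow>
           weak_solution T L (H_elastic lam_e mu_e) (H_visco \<delta> lam_v mu_v) k chi s (G s)"
  shows "\<not> hessian_L1_bounded T (reduced_objective T L lam G u0 p0 ud pd)"
proof
  let ?j = "reduced_objective T L lam G u0 p0 ud pd"
  let ?M = "ivl T \<Otimes>\<^sub>M ivl L"
  assume "hessian_L1_bounded T ?j"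
  then obtain B C where growth: "\<And>\<psi>. \<psi> \<in> l2_space (ivl T) \<Longrightarrow>
    ?j \<psi> \<le> ?j (\<lambda>_. 0) + B * l2_norm (ivl T) \<psi> + C * (l1_norm (ivl T) \<psi>)\<^sup>2"
    using hessian_L1_bounded_growth by blast
  define He Hv where "He = H_elastic lam_e mu_e" and "Hv = H_visco \<delta> lam_v mu_v"
  have Hv: "Hv \<noteq> 0" using assms(5-7) by (simp add: Hv_def H_visco_def)
  define a where "a = He / Hv"
  obtain \<rho> where \<rho>: "\<rho> > 0"
    "\<And>\<phi> u p. \<phi> \<in> test_funs T \<Longrightarrow>
      weak_solution T L He Hv k chi (\<lambda>t. deriv \<phi> t - a * \<phi> t) (u, p) \<Longrightarrow>
      (\<integral>t. (deriv \<phi> t - a * \<phi> t)\<^sup>2 \<partial>ivl T)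
        \<le> \<rho> * (\<integral>(t, x). (p t x)\<^sup>2 \<partial>?M) + (\<integral>t. (\<phi> t)\<^sup>2 \<partial>ivl T)"
    using pressure_controls_source[OF assms(2) Hv assms(10,11), of T He k] unfolding a_def by blast
  \<comment> \<open>The fixed offset between the pressure produced by the control and the pressure
    misfit r: p = r + b, so ||p||^2 <= 2 ||r||^2 + 2 N.\<close>
  define b where "b t x = pd t x - p0 t x" for t x
  have p0: "p0 \<in> L2L2 T L" using assms(15) by (simp add: L2V0_def)
  have b: "b \<in> L2L2 T L" unfolding b_def by (intro L2L2_diff assms p0)
  define N where "N = (\<integral>(t, x). (b t x)\<^sup>2 \<partial>?M)"
  \<comment> \<open>The factor 4 combines ||r||^2 <= 2 j(s) with the 2 from splitting p. The L1 norm
    of s is at most 8 + |a| T, and the final T bounds ||\<phi>||^2.\<close>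
  define K0 where "K0 = \<rho> * (4 * (\<bar>?j (\<lambda>_. 0)\<bar> + \<bar>C\<bar> * (8 + \<bar>a\<bar> * T)\<^sup>2) + 2 * N) + T"
  define K1 where "K1 = \<rho> * 4 * \<bar>B\<bar>"
  have K1: "K1 \<ge> 0" using \<rho> by (simp add: K1_def)
  \<comment> \<open>S will be the squared L2 norm of a source. Neither constant depends on R, so
    arbitrarily large S satisfying this inequality are impossible.\<close>
  have "\<exists>S. (S \<ge> R \<and> S \<le> K0 + K1 * sqrt S)" for R
  proof -
    \<comment> \<open>The first entry makes the steep bump available. The second turns the estimate
      n / 8 <= 2 S + 2 a^2 T, obtained below from \<phi>' = s + a \<phi>, into |R| <= S.\<close>
    define n where "n = max (2 / T + 1) (16 * (\<bar>R\<bar> + a\<^sup>2 * T))"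
    have "n > 2 / T" by (simp add: n_def)
    then obtain \<phi> where \<phi>: "\<phi> \<in> test_funs T" "\<And>t. \<bar>\<phi> t\<bar> \<le> 1"
      "(\<integral>t. \<bar>deriv \<phi> t\<bar> \<partial>ivl T) \<le> 8" "n / 8 \<le> (\<integral>t. (deriv \<phi> t)\<^sup>2 \<partial>ivl T)"
      using ex_steep_test_function[OF assms(1)] by blast
    note c = test_funs_props(2,3)[OF \<phi>(1)]
    define s where "s t = deriv \<phi> t - a * \<phi> t" for t
    have cs: "continuous_on UNIV s" unfolding s_def by (intro continuous_intros c)
    have s: "s \<in> l2_space (ivl T)" by (rule l2_space_continuous[OF cs])
    define S where "S = (\<integral>t. (s t)\<^sup>2 \<partial>ivl T)"
    have iT: "integrable (ivl T) f" if "continuous_on UNIV f" for f :: "real \<Rightarrow> real"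
      using that by (rule integrable_continuous_ivl)
    have \<phi>2: "(\<integral>t. (\<phi> t)\<^sup>2 \<partial>ivl T) \<le> T"
    proof -
      have "(\<integral>t. (\<phi> t)\<^sup>2 \<partial>ivl T) \<le> (\<integral>t. 1 \<partial>ivl T)"
      proof (rule integral_mono)
        show "(\<phi> t)\<^sup>2 \<le> 1" for t using power_mono[OF \<phi>(2)[of t], of 2] by simp
      qed (intro iT continuous_intros c)+
      then show ?thesis using assms(1) by (simp add: measure_ivl)
    qed
    have s1: "l1_norm (ivl T) s \<le> 8 + \<bar>a\<bar> * T"
    proof -
      have "l1_norm (ivl T) s \<le> (\<integral>t. \<bar>deriv \<phi> t\<bar> + \<bar>a\<bar> * 1 \<partial>ivl T)"
        unfolding l1_norm_def
      proof (rule integral_mono)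
        fix t
        have "\<bar>s t\<bar> \<le> \<bar>deriv \<phi> t\<bar> + \<bar>a * \<phi> t\<bar>" unfolding s_def by (rule abs_triangle_ineq4)
        also have "\<bar>a * \<phi> t\<bar> \<le> \<bar>a\<bar> * 1" unfolding abs_mult by (intro mult_left_mono \<phi>) auto
        finally show "\<bar>s t\<bar> \<le> \<bar>deriv \<phi> t\<bar> + \<bar>a\<bar> * 1" by simp
      qed (intro iT continuous_intros c cs)+
      also have "\<dots> = (\<integral>t. \<bar>deriv \<phi> t\<bar> \<partial>ivl T) + (\<integral>t. \<bar>a\<bar> * 1 \<partial>ivl T)"
        by (intro Bochner_Integration.integral_add iT continuous_intros c)
      finally show ?thesis using \<phi>(3) assms(1) by (simp add: measure_ivl mult.commute)
    qed
    have "R \<le> S"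
    proof -
      have "(\<integral>t. (deriv \<phi> t)\<^sup>2 \<partial>ivl T) \<le> (\<integral>t. 2 * (s t)\<^sup>2 + 2 * a\<^sup>2 * (\<phi> t)\<^sup>2 \<partial>ivl T)"
      proof (rule integral_mono)
        fix t
        have "0 \<le> (s t - a * \<phi> t)\<^sup>2" by simp
        then show "(deriv \<phi> t)\<^sup>2 \<le> 2 * (s t)\<^sup>2 + 2 * a\<^sup>2 * (\<phi> t)\<^sup>2"
          by (simp add: s_def power2_eq_square algebra_simps)
      qed (intro iT continuous_intros c cs)+
      also have "\<dots> = (\<integral>t. 2 * (s t)\<^sup>2 \<partial>ivl T) + (\<integral>t. 2 * a\<^sup>2 * (\<phi> t)\<^sup>2 \<partial>ivl T)"
        by (intro Bochner_Integration.integral_add iT continuous_intros c cs)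
      also have "\<dots> = 2 * S + 2 * a\<^sup>2 * (\<integral>t. (\<phi> t)\<^sup>2 \<partial>ivl T)" by (simp add: S_def)
      also have "\<dots> \<le> 2 * S + 2 * a\<^sup>2 * T" using \<phi>2 by (intro add_left_mono mult_left_mono) auto
      finally have "n / 8 \<le> 2 * S + 2 * a\<^sup>2 * T" using \<phi>(4) by simp
      moreover have "16 * (\<bar>R\<bar> + a\<^sup>2 * T) \<le> n" by (simp add: n_def)
      ultimately show ?thesis by (simp add: algebra_simps)
    qed
    moreover have "S \<le> K0 + K1 * sqrt S"
    proof -
      obtain u p where G: "G s = (u, p)" by fastforce
      have sol: "weak_solution T L He Hv k chi s (u, p)"
        using assms(16)[OF s] G by (simp add: He_def Hv_def)
      have p: "p \<in> L2L2 T L" using sol by (auto simp: weak_solution_def L2V0_def)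
      define r where "r t x = p t x + p0 t x - pd t x" for t x
      have r: "r \<in> L2L2 T L" unfolding r_def by (intro L2L2_diff L2L2_add assms p p0)
      have "(\<integral>(t, x). (r t x)\<^sup>2 \<partial>?M) = (L2L2_norm T L r)\<^sup>2" using L2L2_norm_sq[OF r] by simp
      \<comment> \<open>The displacement misfit in the objective is nonnegative, so the pressure
        misfit alone is at most twice the objective.\<close>
      also have "\<dots> \<le> 2 * ?j s"
        unfolding reduced_objective_def G assms(9) r_def by simp
      also have "\<dots> \<le> 2 * (?j (\<lambda>_. 0) + B * sqrt S + C * (l1_norm (ivl T) s)\<^sup>2)"
        using growth[OF s] by (simp add: l2_norm_def S_def)
      also have "\<dots> \<le> 2 * (\<bar>?j (\<lambda>_. 0)\<bar> + \<bar>B\<bar> * sqrt S + \<bar>C\<bar> * (8 + \<bar>a\<bar> * T)\<^sup>2)"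
      proof -
        have "C * (l1_norm (ivl T) s)\<^sup>2 \<le> \<bar>C\<bar> * (l1_norm (ivl T) s)\<^sup>2" by (intro mult_right_mono) auto
        also have "\<dots> \<le> \<bar>C\<bar> * (8 + \<bar>a\<bar> * T)\<^sup>2"
          by (intro mult_left_mono power_mono s1) (auto simp: l1_norm_def)
        finally have "C * (l1_norm (ivl T) s)\<^sup>2 \<le> \<bar>C\<bar> * (8 + \<bar>a\<bar> * T)\<^sup>2" .
        moreover have "B * sqrt S \<le> \<bar>B\<bar> * sqrt S" by (intro mult_right_mono) (auto simp: S_def)
        ultimately show ?thesis by (intro mult_left_mono add_mono abs_ge_self) auto
      qed
      finally have r2: "(\<integral>(t, x). (r t x)\<^sup>2 \<partial>?M) \<le> 2 * (\<bar>?j (\<lambda>_. 0)\<bar> + \<bar>B\<bar> * sqrt S + \<bar>C\<bar> * (8 + \<bar>a\<bar> * T)\<^sup>2)" .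
      have int: "integrable ?M (\<lambda>z. (r (fst z) (snd z))\<^sup>2)" "integrable ?M (\<lambda>z. (b (fst z) (snd z))\<^sup>2)"
        "integrable ?M (\<lambda>z. (p (fst z) (snd z))\<^sup>2)"
        using r b p by (simp_all add: L2L2_def l2_space_def case_prod_unfold)
      have "(\<integral>(t, x). (p t x)\<^sup>2 \<partial>?M) = (\<integral>z. (p (fst z) (snd z))\<^sup>2 \<partial>?M)" by (simp add: case_prod_unfold)
      also have "\<dots> \<le> (\<integral>z. 2 * (r (fst z) (snd z))\<^sup>2 + 2 * (b (fst z) (snd z))\<^sup>2 \<partial>?M)"
      proof (rule integral_mono)
        fix z
        have "0 \<le> (r (fst z) (snd z) - b (fst z) (snd z))\<^sup>2" by simp
        moreover have "p (fst z) (snd z) = r (fst z) (snd z) + b (fst z) (snd z)" by (simp add: r_def b_def)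
        ultimately show "(p (fst z) (snd z))\<^sup>2 \<le> 2 * (r (fst z) (snd z))\<^sup>2 + 2 * (b (fst z) (snd z))\<^sup>2"
          by (simp add: power2_sum power2_diff)
      qed (intro Bochner_Integration.integrable_add integrable_mult_right int)+
      also have "\<dots> = 2 * (\<integral>(t, x). (r t x)\<^sup>2 \<partial>?M) + 2 * N"
        using int by (simp add: N_def case_prod_unfold)
      finally have p2: "(\<integral>(t, x). (p t x)\<^sup>2 \<partial>?M) \<le> 4 * (\<bar>?j (\<lambda>_. 0)\<bar> + \<bar>B\<bar> * sqrt S + \<bar>C\<bar> * (8 + \<bar>a\<bar> * T)\<^sup>2) + 2 * N"
        using r2 by simp
      have "S \<le> \<rho> * (\<integral>(t, x). (p t x)\<^sup>2 \<partial>?M) + (\<integral>t. (\<phi> t)\<^sup>2 \<partial>ivl T)"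
        using \<rho>(2)[OF \<phi>(1)] sol unfolding S_def s_def by blast
      also have "\<dots> \<le> \<rho> * (4 * (\<bar>?j (\<lambda>_. 0)\<bar> + \<bar>B\<bar> * sqrt S + \<bar>C\<bar> * (8 + \<bar>a\<bar> * T)\<^sup>2) + 2 * N) + T"
        using \<rho>(1) by (intro add_mono mult_left_mono p2 \<phi>2) auto
      also have "\<dots> = K0 + K1 * sqrt S" by (simp add: K0_def K1_def algebra_simps)
      finally show ?thesis .
    qed
    ultimately show ?thesis by blast
  qed
  \<comment> \<open>For this R both sqrt S - K1 >= |K0| + 1 and sqrt S >= 1, so S - K1 sqrt S is at
    least |K0| + 1, whereas the second inequality bounds it by K0.\<close>
  then obtain S where S: "S \<ge> (\<bar>K0\<bar> + K1 + 1)\<^sup>2" "S \<le> K0 + K1 * sqrt S" by blast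
  then have S0: "S \<ge> 0" by (meson order_trans zero_le_power2)
  have q: "sqrt S \<ge> \<bar>K0\<bar> + K1 + 1" using S(1) K1 by (intro real_le_rsqrt) auto
  then have "(\<bar>K0\<bar> + 1) * 1 \<le> (sqrt S - K1) * sqrt S" using K1 by (intro mult_mono) linarith+
  also have "\<dots> = S - K1 * sqrt S" using S0 by (simp add: left_diff_distrib)
  also have "\<dots> \<le> K0" using S(2) by simp
  finally have "\<bar>K0\<bar> + 1 \<le> K0" by (simp only: mult_1_right)
  then show False using abs_ge_self[of K0] by simp
qed

end
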